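(* For each $1<p<\infty$ there exists a positive constant $c_p$, depending only on $p$, such that the following holds. Let $(d_k)_{k\ge1}$ and $(e_k)_{k\ge1}$ be real-valued martingale difference sequences on $[0,1]^{\mathbb{N}}$ with respect to the filtration $(\mathcal{L}_k)_{k\ge0}$. Let $(T_k)_{k\ge1}$ be such that for each $k$, $T_k(x_1,\dots,x_{k-1})$ is a linear operator, depending measurably on $(x_1,\dots,x_{k-1})\in[0,1]^{k-1}$, that is bounded on both $L_1([0,1])$ and $L_\infty([0,1])$ with norm at most $1$ on each. Suppose that for every $k\ge1$ and almost all $x_1,\dots,x_{k-1}$, $$e_k(x_1,\dots,x_{k-1},\cdot)=[T_k(x_1,\dots,x_{k-1})]\,d_k(x_1,\dots,x_{k-1},\cdot).$$ Then for all positive integers $n$, $$\left\|\sum_{k=1}^n e_k\right\|_p\le c_p\left\|\sum_{k=1}^n d_k\right\|_p .$$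
   Context: The probability space is $[0,1]^{\mathbb{N}}$ with the product Lebesgue measure. $\mathcal{L}_k$ is the minimal $\sigma$-field for which the first $k$ coordinate functions $x_1,\dots,x_k$ are measurable ($\mathcal{L}_0$ is trivial). An $\mathcal{L}_k$-measurable random variable is regarded as a function of $(x_1,\dots,x_k)$. $(d_k)_{k\ge1}$ is a martingale difference sequence with respect to $(\mathcal{L}_k)$ if each $d_k$ is integrable and $\mathcal{L}_k$-measurable and $E[d_k\mid\mathcal{L}_{k-1}]=0$ for all $k\ge1$. The spaces $L_1([0,1])$, $L_\infty([0,1])$ are real, with respect to Lebesgue measure. "Depending measurably" means that for each $f\in L_1([0,1])$ the map $(x_1,\dots,x_{k-1})\mapsto T_k(x_1,\dots,x_{k-1})f\in L_1([0,1])$ is measurable. $\|X\|_p=(E|X|^p)^{1/p}$, which may be $+\infty$. *)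

theory Defs
  imports "HOL-Probability.Probability"
begin

section \<open>The unit interval and the Lebesgue space of integrable functions on it\<close>

definition leb01 :: "real measure" where
  "leb01 = restrict_space lborel {0..1}"

lemma space_leb01 [simp]: "space leb01 = {0..1}"
  by (simp add: leb01_def space_restrict_space)

lemma prob_space_leb01: "prob_space leb01"
  by (rule prob_spaceI) (simp add: leb01_def emeasure_restrict_space space_restrict_space)

definition L1rel :: "(real \<Rightarrow> real) \<Rightarrow> (real \<Rightarrow> real) \<Rightarrow> bool" where
  "L1rel f g \<longleftrightarrow> integrable leb01 f \<and> integrable leb01 g \<and> (AE t in leb01. f t = g t)"

text \<open>The relation is partial, so \<open>abs_L1 f\<close> is meaningful only if \<open>f\<close> is integrable.\<close>

quotient_type L1 = "real \<Rightarrow> real" / partial: L1rel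
proof (rule part_equivpI)
  show "\<exists>x. L1rel x x"
    by (rule exI[of _ "\<lambda>_. 0"]) (simp add: L1rel_def)
  show "symp L1rel"
    by (auto simp: symp_def L1rel_def)
  show "transp L1rel"
    by (auto simp: transp_def L1rel_def)
qed

instantiation L1 :: real_normed_vector
begin

lift_definition zero_L1 :: L1 is "\<lambda>_. 0"
  by (simp add: L1rel_def)

lift_definition plus_L1 :: "L1 \<Rightarrow> L1 \<Rightarrow> L1" is "\<lambda>f g t. f t + g t"
  by (auto simp: L1rel_def)

lift_definition minus_L1 :: "L1 \<Rightarrow> L1 \<Rightarrow> L1" is "\<lambda>f g t. f t - g t"
  by (auto simp: L1rel_def)

lift_definition uminus_L1 :: "L1 \<Rightarrow> L1" is "\<lambda>f t. - f t"
  by (auto simp: L1rel_def)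

lift_definition scaleR_L1 :: "real \<Rightarrow> L1 \<Rightarrow> L1" is "\<lambda>c f t. c * f t"
  by (auto simp: L1rel_def)

lift_definition norm_L1 :: "L1 \<Rightarrow> real" is "\<lambda>f. \<integral>t. \<bar>f t\<bar> \<partial>leb01"
  by (auto simp: L1rel_def intro!: integral_cong_AE)

definition dist_L1 :: "L1 \<Rightarrow> L1 \<Rightarrow> real" where
  "dist_L1 f g = norm (f - g)"

definition sgn_L1 :: "L1 \<Rightarrow> L1" where
  "sgn_L1 f = scaleR (inverse (norm f)) f"

definition uniformity_L1 :: "(L1 \<times> L1) filter" where
  "uniformity_L1 = (INF e\<in>{0 <..}. principal {(f, g). dist f g < e})"

definition open_L1 :: "L1 set \<Rightarrow> bool" where
  "open_L1 S \<longleftrightarrow> (\<forall>f\<in>S. \<forall>\<^sub>F (f', g) in uniformity. f' = f \<longrightarrow> g \<in> S)"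

instance
proof
  fix f g h :: L1 and a b :: real
  show "f + g + h = f + (g + h)" by transfer (auto simp: L1rel_def algebra_simps)
  show "f + g = g + f" by transfer (auto simp: L1rel_def algebra_simps)
  show "0 + f = f" by transfer (auto simp: L1rel_def)
  show "- f + f = 0" by transfer (auto simp: L1rel_def)
  show "f - g = f + - g" by transfer (auto simp: L1rel_def)
  show "a *\<^sub>R (f + g) = a *\<^sub>R f + a *\<^sub>R g" by transfer (auto simp: L1rel_def algebra_simps)
  show "(a + b) *\<^sub>R f = a *\<^sub>R f + b *\<^sub>R f" by transfer (auto simp: L1rel_def algebra_simps)
  show "a *\<^sub>R b *\<^sub>R f = (a * b) *\<^sub>R f" by transfer (auto simp: L1rel_def algebra_simps)
  show "1 *\<^sub>R f = f" by transfer (auto simp: L1rel_def)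
  show "dist f g = norm (f - g)" by (rule dist_L1_def)
  show "sgn f = inverse (norm f) *\<^sub>R f" by (rule sgn_L1_def)
  show "uniformity = (INF e\<in>{0 <..}. principal {(f, g :: L1). dist f g < e})"
    by (rule uniformity_L1_def)
  show "open S \<longleftrightarrow> (\<forall>f\<in>S. \<forall>\<^sub>F (f', g) in uniformity. f' = f \<longrightarrow> g \<in> S)" for S :: "L1 set"
    by (rule open_L1_def)
  show "norm f = 0 \<longleftrightarrow> f = 0"
    by transfer (auto simp: L1rel_def integral_nonneg_eq_0_iff_AE)
  show "norm (f + g) \<le> norm f + norm g"
  proof transfer
    fix f g :: "real \<Rightarrow> real"
    assume "L1rel f f" "L1rel g g"
    then have [simp]: "integrable leb01 f" "integrable leb01 g" by (auto simp: L1rel_def)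
    have "(\<integral>t. \<bar>f t + g t\<bar> \<partial>leb01) \<le> (\<integral>t. \<bar>f t\<bar> + \<bar>g t\<bar> \<partial>leb01)"
      by (rule integral_mono) auto
    then show "(\<integral>t. \<bar>f t + g t\<bar> \<partial>leb01) \<le> (\<integral>t. \<bar>f t\<bar> \<partial>leb01) + (\<integral>t. \<bar>g t\<bar> \<partial>leb01)"
      by simp
  qed
  show "norm (a *\<^sub>R f) = \<bar>a\<bar> * norm f"
    by transfer (simp add: abs_mult)
qed

end

lift_definition Linf_norm :: "L1 \<Rightarrow> ennreal" is "\<lambda>f. esssup leb01 (\<lambda>t. ennreal \<bar>f t\<bar>)"
proof -
  fix f g assume "L1rel f g"
  then show "esssup leb01 (\<lambda>t. ennreal \<bar>f t\<bar>) = esssup leb01 (\<lambda>t. ennreal \<bar>g t\<bar>)"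
    by (intro esssup_AE_cong) (auto simp: L1rel_def)
qed

text \<open>Since the interval has finite measure, the essentially bounded classes are the
  \<open>f :: L1\<close> with \<open>Linf_norm f < \<infinity>\<close>.\<close>

definition L1_Linf_contraction :: "(L1 \<Rightarrow> L1) \<Rightarrow> bool" where
  "L1_Linf_contraction S \<longleftrightarrow>
     bounded_linear S \<and> onorm S \<le> 1 \<and>
     (\<forall>f. Linf_norm f < \<infinity> \<longrightarrow> Linf_norm (S f) \<le> Linf_norm f)"


section \<open>The infinite product space, its filtration and martingale differences\<close>

text \<open>Coordinates are indexed by \<open>1, 2, \<dots>\<close>; points are functions that are \<open>undefined\<close> at \<open>0\<close>.\<close>

definition cube :: "(nat \<Rightarrow> real) measure" where
  "cube = (\<Pi>\<^sub>M i\<in>{1..}. leb01)"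

definition coord_alg :: "nat \<Rightarrow> (nat \<Rightarrow> real) measure" where
  "coord_alg k = sigma (space cube)
     {(\<lambda>\<omega>. \<omega> i) -` A \<inter> space cube | i A. i \<in> {1..k} \<and> A \<in> sets leb01}"

text \<open>Needed because \<open>real_cond_exp M F\<close> is zero by convention when \<open>F\<close> is not a subalgebra.\<close>

lemma subalgebra_coord_alg: "subalgebra cube (coord_alg k)"
proof -
  let ?G = "{(\<lambda>\<omega>. \<omega> i) -` A \<inter> space cube | i A. i \<in> {1..k} \<and> A \<in> sets leb01}"
  have "?G \<subseteq> sets cube"
    by (auto simp: cube_def intro!: measurable_sets[OF measurable_component_singleton])
  then have "sigma_sets (space cube) ?G \<subseteq> sets cube"
    by (rule sets.sigma_sets_subset)
  moreover have "?G \<subseteq> Pow (space cube)" by blast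
  ultimately show ?thesis
    unfolding subalgebra_def coord_alg_def by (simp add: sets_measure_of space_measure_of)
qed

definition martingale_diff_seq ::
    "'a measure \<Rightarrow> (nat \<Rightarrow> 'a measure) \<Rightarrow> (nat \<Rightarrow> 'a \<Rightarrow> real) \<Rightarrow> bool" where
  "martingale_diff_seq M F d \<longleftrightarrow>
     (\<forall>k\<ge>1. integrable M (d k) \<and> d k \<in> borel_measurable (F k) \<and>
        (AE \<omega> in M. real_cond_exp M (F (k - 1)) (d k) \<omega> = 0))"

text \<open>The point \<open>(x\<^sub>1, \<dots>, x\<^sub>k\<^sub>-\<^sub>1, t, 0, 0, \<dots>)\<close>. The choice of the later coordinates is immaterial for
  functions measurable with respect to the first \<open>k\<close> coordinates; see \<open>coord_alg_determined\<close>.\<close>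

definition extend_point :: "nat \<Rightarrow> (nat \<Rightarrow> real) \<Rightarrow> real \<Rightarrow> (nat \<Rightarrow> real)" where
  "extend_point k x t = (\<lambda>i\<in>{1..}. if i < k then x i else if i = k then t else 0)"

definition slice :: "nat \<Rightarrow> ((nat \<Rightarrow> real) \<Rightarrow> real) \<Rightarrow> (nat \<Rightarrow> real) \<Rightarrow> real \<Rightarrow> real" where
  "slice k X x = (\<lambda>t. X (extend_point k x t))"

lemma coord_alg_determined:
  fixes X :: "(nat \<Rightarrow> real) \<Rightarrow> real"
  assumes X: "X \<in> borel_measurable (coord_alg k)"
    and v: "v \<in> space cube" and w: "w \<in> space cube"
    and eq: "\<And>i. i \<in> {1..k} \<Longrightarrow> v i = w i"
  shows "X v = X w"
proof -
  let ?G = "{(\<lambda>\<omega>. \<omega> i) -` A \<inter> space cube | i A. i \<in> {1..k} \<and> A \<in> sets leb01}"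
  have G: "?G \<subseteq> Pow (space cube)" by blast
  have inv: "v \<in> B \<longleftrightarrow> w \<in> B" if "B \<in> sigma_sets (space cube) ?G" for B
    using that by induction (use v w eq in auto)
  have "X -` {X v} \<inter> space (coord_alg k) \<in> sets (coord_alg k)"
    by (rule measurable_sets[OF X]) simp
  then have "X -` {X v} \<inter> space cube \<in> sigma_sets (space cube) ?G"
    using G by (simp add: coord_alg_def sets_measure_of space_measure_of)
  from inv[OF this] v w show ?thesis by auto
qed

text \<open>The \<open>L\<^sub>p\<close> norm with values in \<open>[0, \<infinity>]\<close>.\<close>

definition Lp_norm :: "real \<Rightarrow> 'a measure \<Rightarrow> ('a \<Rightarrow> real) \<Rightarrow> ennreal" where
  "Lp_norm p M X =
     (let I = (\<integral>\<^sup>+\<omega>. ennreal (\<bar>X \<omega>\<bar> powr p) \<partial>M)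
      in if I = \<infinity> then \<infinity> else ennreal (enn2real I powr (1 / p)))"

end

theory Submission
  imports Defs
begin

text \<open>A Bellman function proof, uniform in \<open>1 < p < \<infinity>\<close>. Clipping \<open>d\<^sub>k\<close> at a level \<open>a\<close> shows that,
  conditionally on the past, \<open>E (\<bar>e\<^sub>k\<bar> - a)\<^sup>+ \<le> E (\<bar>d\<^sub>k\<bar> - a)\<^sup>+\<close> for all \<open>a > 0\<close>; hence the same comparison
  holds, with weights depending on the past, for every increasing convex function of \<open>\<bar>e\<^sub>k\<bar>\<close> and
  \<open>\<bar>d\<^sub>k\<bar>\<close>. On the other hand the explicit potential
  \<open>U(x, y) = (2\<^sup>p + 1) \<parallel>(\<epsilon>x, y)\<parallel>\<^sup>p - \<parallel>(x, y)\<parallel>\<^sup>p\<close> satisfies, with \<open>r = \<parallel>(x, y)\<parallel>\<close>,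
  \<open>U(x + d, y + e) \<le> U(x, y) + \<nabla>U(x, y) \<cdot> (d, e) + A \<Psi>\<^sub>r(e) - C \<Psi>\<^sub>r(d)\<close> for \<^emph>\<open>arbitrary\<close> \<open>d, e\<close>, where
  \<open>\<Psi>\<^sub>r(t)\<close> is comparable to \<open>t\<^sup>2 (r + \<bar>t\<bar>)\<^sup>p\<^sup>-\<^sup>2\<close> and therefore to a convex function. No coupling between
  \<open>d\<^sub>k\<close> and \<open>e\<^sub>k\<close> is needed, and replacing \<open>d\<close> by \<open>L d\<close> makes the error term nonpositive in mean. So
  \<open>E U(L \<Sum>d, \<Sum>e) \<le> 0\<close>, and \<open>U(x, y) \<ge> \<bar>y\<bar>\<^sup>p - 2\<^sup>p \<bar>x\<bar>\<^sup>p\<close> gives the theorem.\<close>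

section \<open>Second-order bounds for powers of the norm\<close>

lemma powr_square_split:
  assumes "0 \<le> (x::real)" shows "x powr p = x powr (p - 2) * x\<^sup>2"
proof (cases "x = 0")
  case False
  then show ?thesis using assms powr_add[of x "p - 2" 2] by (simp add: powr_numeral)
qed simp

text \<open>For \<open>p \<le> 2\<close> the second derivative
  \<open>p * (p - 1) * t powr (p - 2)\<close> is nonincreasing, so on \<open>{0<..\<rho>}\<close>
  subtracting the quadratic with its value at \<open>\<rho>\<close> leaves a convex function. The
  cases \<open>u = 0\<close> and \<open>v = 0\<close> lie outside the domain of the derivatives and
  are checked directly.\<close>

lemma powr_tangent_remainder_le_2:
  fixes p u v \<rho> :: real
  assumes p: "1 < p" "p \<le> 2" and uv: "0 \<le> u" "0 \<le> v" "u \<le> \<rho>" "v \<le> \<rho>"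
  shows "p * (p - 1) / 2 * \<rho> powr (p - 2) * (v - u)\<^sup>2 \<le>
    v powr p - u powr p - p * u powr (p - 1) * (v - u)"
proof -
  let ?\<kappa> = "p * (p - 1) / 2 * \<rho> powr (p - 2)"
  have \<kappa>1: "p * (p - 1) / 2 \<le> 1"
  proof -
    have "p * (p - 1) \<le> 2 * 1" using p by (intro mult_mono) auto
    then show ?thesis by simp
  qed
  have mon: "\<rho> powr (p - 2) \<le> x powr (p - 2)" if "0 < x" "x \<le> \<rho>" for x
    using that p by (intro powr_mono2') auto
  consider "u = 0" | "u > 0" "v = 0" | "u > 0" "v > 0" using uv by fastforce
  then show ?thesis
  proof cases
    case 1
    show ?thesis
    proof (cases "v = 0")
      case False
      have "?\<kappa> \<le> 1 * v powr (p - 2)" using \<kappa>1 mon[of v] False uv p by (intro mult_mono) auto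
      then have "?\<kappa> * v\<^sup>2 \<le> v powr (p - 2) * v\<^sup>2" by (intro mult_right_mono) auto
      then show ?thesis using 1 powr_square_split[of v p] uv by simp
    qed (use 1 in auto)
  next
    case 2
    have "p / 2 * \<rho> powr (p - 2) \<le> 1 * u powr (p - 2)"
      using mon[of u] 2 uv p by (intro mult_mono) auto
    then have "p / 2 * \<rho> powr (p - 2) * u\<^sup>2 \<le> u powr (p - 2) * u\<^sup>2"
      by (intro mult_right_mono) auto
    then have "(p - 1) * (p / 2 * \<rho> powr (p - 2) * u\<^sup>2) \<le> (p - 1) * u powr p"
      using p powr_square_split[of u p] uv by (intro mult_left_mono) auto
    moreover have "u powr (p - 1) * u = u powr p"
      using powr_add[of u "p - 1" 1] 2 by simp
    ultimately show ?thesis using 2 by (simp add: algebra_simps)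
  next
    case 3
    let ?f = "\<lambda>t. t powr p - ?\<kappa> * t\<^sup>2"
    let ?f' = "\<lambda>t. p * t powr (p - 1) - ?\<kappa> * (2 * t)"
    let ?f'' = "\<lambda>t. p * ((p - 1) * t powr (p - 1 - 1)) - ?\<kappa> * 2"
    have "?f' u * (v - u) \<le> ?f v - ?f u"
    proof (rule f''_imp_f'[where C = "{0<..\<rho>}"])
      fix t assume t: "t \<in> {0<..\<rho>}"
      show "(?f has_real_derivative ?f' t) (at t)"
        using t by (auto intro!: derivative_eq_intros)
      show "(?f' has_real_derivative ?f'' t) (at t)"
        using t by (auto intro!: derivative_eq_intros)
      have "p * (p - 1) * \<rho> powr (p - 2) \<le> p * (p - 1) * t powr (p - 2)"
        using t p mon[of t] by (intro mult_left_mono) auto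
      then show "0 \<le> ?f'' t" by (simp add: field_simps)
    qed (use 3 uv in auto)
    moreover have "k * (v - u)\<^sup>2 = k * v\<^sup>2 - k * u\<^sup>2 - k * (2 * u) * (v - u)" for k
      by (simp add: power2_eq_square algebra_simps)
    ultimately show ?thesis by (simp add: left_diff_distrib)
  qed
qed

text \<open>For \<open>p \<ge> 2\<close> the second derivative is nondecreasing, so its value at
  \<open>\<rho>\<close> bounds it from above and the quadratic minus the power is convex.\<close>

lemma powr_tangent_remainder_ge_2:
  fixes p u v \<rho> :: real
  assumes p: "2 \<le> p" and uv: "0 \<le> u" "0 \<le> v" "u \<le> \<rho>" "v \<le> \<rho>"
  shows "v powr p - u powr p - p * u powr (p - 1) * (v - u) \<le>
    p * (p - 1) / 2 * \<rho> powr (p - 2) * (v - u)\<^sup>2"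
proof -
  let ?\<kappa> = "p * (p - 1) / 2 * \<rho> powr (p - 2)"
  have \<kappa>1: "1 \<le> p * (p - 1) / 2"
  proof -
    have "2 * 1 \<le> p * (p - 1)" using p by (intro mult_mono) auto
    then show ?thesis by simp
  qed
  have mon: "x powr (p - 2) \<le> \<rho> powr (p - 2)" if "0 < x" "x \<le> \<rho>" for x
    using that p by (intro powr_mono2) auto
  consider "u = 0" | "u > 0" "v = 0" | "u > 0" "v > 0" using uv by fastforce
  then show ?thesis
  proof cases
    case 1
    show ?thesis
    proof (cases "v = 0")
      case False
      have "1 * v powr (p - 2) \<le> ?\<kappa>" using \<kappa>1 mon[of v] False uv p by (intro mult_mono) auto
      then have "v powr (p - 2) * v\<^sup>2 \<le> ?\<kappa> * v\<^sup>2" by (intro mult_right_mono) auto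
      then show ?thesis using 1 powr_square_split[of v p] uv by simp
    qed (use 1 in auto)
  next
    case 2
    have "1 * u powr (p - 2) \<le> p / 2 * \<rho> powr (p - 2)"
      using mon[of u] 2 uv p by (intro mult_mono) auto
    then have "u powr (p - 2) * u\<^sup>2 \<le> p / 2 * \<rho> powr (p - 2) * u\<^sup>2"
      by (intro mult_right_mono) auto
    then have "(p - 1) * u powr p \<le> (p - 1) * (p / 2 * \<rho> powr (p - 2) * u\<^sup>2)"
      using p powr_square_split[of u p] uv by (intro mult_left_mono) auto
    moreover have "u powr (p - 1) * u = u powr p"
      using powr_add[of u "p - 1" 1] 2 by simp
    ultimately show ?thesis using 2 by (simp add: algebra_simps)
  next
    case 3
    let ?f = "\<lambda>t. ?\<kappa> * t\<^sup>2 - t powr p"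
    let ?f' = "\<lambda>t. ?\<kappa> * (2 * t) - p * t powr (p - 1)"
    let ?f'' = "\<lambda>t. ?\<kappa> * 2 - p * ((p - 1) * t powr (p - 1 - 1))"
    have "?f' u * (v - u) \<le> ?f v - ?f u"
    proof (rule f''_imp_f'[where C = "{0<..\<rho>}"])
      fix t assume t: "t \<in> {0<..\<rho>}"
      show "(?f has_real_derivative ?f' t) (at t)"
        using t by (auto intro!: derivative_eq_intros)
      show "(?f' has_real_derivative ?f'' t) (at t)"
        using t by (auto intro!: derivative_eq_intros)
      have "p * (p - 1) * t powr (p - 2) \<le> p * (p - 1) * \<rho> powr (p - 2)"
        using t p mon[of t] by (intro mult_left_mono) auto
      then show "0 \<le> ?f'' t" by (simp add: field_simps)
    qed (use 3 uv in auto)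
    moreover have "k * (v - u)\<^sup>2 = k * v\<^sup>2 - k * u\<^sup>2 - k * (2 * u) * (v - u)" for k
      by (simp add: power2_eq_square algebra_simps)
    ultimately show ?thesis by (simp add: left_diff_distrib)
  qed
qed

lemma powr_ge_tangent:
  fixes a b q :: real
  assumes q: "1 \<le> q" and ab: "0 < a" "0 \<le> b"
  shows "a powr q + q * a powr (q - 1) * (b - a) \<le> b powr q"
proof (cases "b = 0")
  case True
  have "a powr (q - 1) * a = a powr q" using powr_add[of a "q - 1" 1] ab by simp
  moreover have "1 * a powr q \<le> q * a powr q" using q by (intro mult_right_mono) auto
  ultimately show ?thesis using True by (simp add: algebra_simps)
next
  case False
  have "q * a powr (q - 1) * (b - a) \<le> b powr q - a powr q"
  proof (rule f''_imp_f'[where C = "{0<..}"])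
    fix t :: real assume t: "t \<in> {0<..}"
    show "((\<lambda>t. t powr q) has_real_derivative q * t powr (q - 1)) (at t)"
      using t by (auto intro!: derivative_eq_intros)
    show "((\<lambda>t. q * t powr (q - 1)) has_real_derivative q * ((q - 1) * t powr (q - 1 - 1))) (at t)"
      using t by (auto intro!: derivative_eq_intros)
    show "0 \<le> q * ((q - 1) * t powr (q - 1 - 1))" using q by auto
  qed (use False ab in auto)
  then show ?thesis by simp
qed

lemma powr_le_tangent:
  fixes a b q :: real
  assumes q: "0 \<le> q" "q \<le> 1" and ab: "0 < a" "0 \<le> b"
  shows "b powr q \<le> a powr q + q * a powr (q - 1) * (b - a)"
proof (cases "b = 0")
  case True
  have "a powr (q - 1) * a = a powr q" using powr_add[of a "q - 1" 1] ab by simp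
  moreover have "q * a powr q \<le> 1 * a powr q" using q by (intro mult_right_mono) auto
  ultimately show ?thesis using True by (simp add: algebra_simps)
next
  case False
  have "- (q * a powr (q - 1)) * (b - a) \<le> - (b powr q) - (- (a powr q))"
  proof (rule f''_imp_f'[where C = "{0<..}"])
    fix t :: real assume t: "t \<in> {0<..}"
    show "((\<lambda>t. - (t powr q)) has_real_derivative - (q * t powr (q - 1))) (at t)"
      using t by (auto intro!: derivative_eq_intros)
    show "((\<lambda>t. - (q * t powr (q - 1))) has_real_derivative - (q * ((q - 1) * t powr (q - 1 - 1)))) (at t)"
      using t by (auto intro!: derivative_eq_intros)
    show "0 \<le> - (q * ((q - 1) * t powr (q - 1 - 1)))"
      using q by (auto simp: mult_nonneg_nonpos mult_nonpos_nonneg)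
  qed (use False ab in auto)
  then show ?thesis by simp
qed

section \<open>Remainders of powers of the norm in an inner product space\<close>

text \<open>At \<open>z = 0\<close> the gradient term vanishes for every \<open>p\<close>, also through \<open>0 powr 0 = 0\<close>.\<close>

definition powr_norm_remainder :: "real \<Rightarrow> 'a::real_inner \<Rightarrow> 'a \<Rightarrow> real" where
  "powr_norm_remainder p z h =
     norm (z + h) powr p - norm z powr p - p * norm z powr (p - 2) * inner z h"

lemma powr_norm_remainder_0 [simp]: "powr_norm_remainder p 0 h = norm h powr p"
  by (simp add: powr_norm_remainder_def)

text \<open>The bracket equals \<open>norm z * norm (z + h) - inner z (z + h)\<close>, the
  Cauchy-Schwarz defect of \<open>z\<close> and \<open>z + h\<close>. This separates the radial
  change from an angular part, which \<open>norm_increment_cauchy\<close> shows to be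
  nonnegative.\<close>

lemma norm_increment_square:
  fixes z h :: "'a::real_inner"
  shows "(norm h)\<^sup>2 = (norm (z + h) - norm z)\<^sup>2 + 2 * (norm z * (norm (z + h) - norm z) - inner z h)"
  by (simp add: power2_norm_eq_inner power2_diff inner_add algebra_simps inner_commute
      power2_eq_square[symmetric])

lemma norm_increment_cauchy:
  fixes z h :: "'a::real_inner"
  shows "0 \<le> norm z * (norm (z + h) - norm z) - inner z h"
proof -
  have "inner z (z + h) \<le> norm z * norm (z + h)" by (rule norm_cauchy_schwarz)
  then show ?thesis
    by (simp add: inner_add algebra_simps power2_norm_eq_inner[symmetric] power2_eq_square)
qed

text \<open>With \<open>u\<close> and \<open>v\<close> the norms of \<open>z\<close> and
  \<open>z + h\<close>, the remainder is the scalar remainder of \<open>t powr p\<close> plus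
  \<open>p * u powr (p - 2) * m\<close>, where \<open>m\<close> is the Cauchy-Schwarz defect. Each
  piece dominates its share of \<open>(norm h)\<^sup>2\<close> in
  \<open>norm_increment_square\<close>.\<close>

lemma powr_norm_remainder_lower_le_2:
  fixes z h :: "'a::real_inner"
  assumes p: "1 < p" "p \<le> 2"
  shows "p * (p - 1) / 2 * (norm z + norm h) powr (p - 2) * (norm h)\<^sup>2 \<le> powr_norm_remainder p z h"
proof (cases "z = 0")
  case True
  have "p * (p - 1) \<le> 2 * 1" using p by (intro mult_mono) auto
  then have "p * (p - 1) / 2 * norm h powr p \<le> 1 * norm h powr p" by (intro mult_right_mono) auto
  then show ?thesis using True powr_square_split[of "norm h" p] by simp
next
  case False
  define u v \<rho> m where "u = norm z" "v = norm (z + h)" "\<rho> = norm z + norm h"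
    "m = u * (v - u) - inner z h"
  note defs = this
  have u: "0 < u" "u \<le> \<rho>" "0 \<le> v" "v \<le> \<rho>" using False by (auto simp: defs norm_triangle_ineq)
  have m: "0 \<le> m" using norm_increment_cauchy[of z h] by (simp add: defs)
  have h: "(norm h)\<^sup>2 = (v - u)\<^sup>2 + 2 * m" using norm_increment_square[of h z] by (simp add: defs)
  have up: "u powr (p - 1) = u powr (p - 2) * u" using powr_add[of u "p - 2" 1] u by simp
  have "p * (p - 1) / 2 * \<rho> powr (p - 2) * (v - u)\<^sup>2 \<le> v powr p - u powr p - p * u powr (p - 1) * (v - u)"
    using powr_tangent_remainder_le_2[of p u v \<rho>] p u by simp
  moreover have "(p - 1) * \<rho> powr (p - 2) \<le> 1 * u powr (p - 2)"
    using p u by (intro mult_mono powr_mono2') auto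
  then have "(p - 1) * \<rho> powr (p - 2) * (p * m) \<le> u powr (p - 2) * (p * m)"
    using p m by (intro mult_right_mono) auto
  ultimately have "p * (p - 1) / 2 * \<rho> powr (p - 2) * (norm h)\<^sup>2 \<le>
      v powr p - u powr p - p * u powr (p - 1) * (v - u) + p * u powr (p - 2) * m"
    unfolding h by (simp add: field_simps)
  also have "\<dots> = v powr p - u powr p - p * u powr (p - 2) * inner z h"
    unfolding up defs(4) by (simp add: algebra_simps)
  finally show ?thesis by (simp add: powr_norm_remainder_def defs)
qed

text \<open>The same radial and angular splitting works, with both comparisons reversed because
  \<open>t powr (p - 2)\<close> is now nondecreasing.\<close>

lemma powr_norm_remainder_upper_ge_2:
  fixes z h :: "'a::real_inner"
  assumes p: "2 \<le> p"
  shows "powr_norm_remainder p z h \<le> p * (p - 1) / 2 * (norm z + norm h) powr (p - 2) * (norm h)\<^sup>2"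
proof (cases "z = 0")
  case True
  have "2 * 1 \<le> p * (p - 1)" using p by (intro mult_mono) auto
  then have "1 * norm h powr p \<le> p * (p - 1) / 2 * norm h powr p" by (intro mult_right_mono) auto
  then show ?thesis using True powr_square_split[of "norm h" p] by simp
next
  case False
  define u v \<rho> m where "u = norm z" "v = norm (z + h)" "\<rho> = norm z + norm h"
    "m = u * (v - u) - inner z h"
  note defs = this
  have u: "0 < u" "u \<le> \<rho>" "0 \<le> v" "v \<le> \<rho>" using False by (auto simp: defs norm_triangle_ineq)
  have m: "0 \<le> m" using norm_increment_cauchy[of z h] by (simp add: defs)
  have h: "(norm h)\<^sup>2 = (v - u)\<^sup>2 + 2 * m" using norm_increment_square[of h z] by (simp add: defs)
  have up: "u powr (p - 1) = u powr (p - 2) * u" using powr_add[of u "p - 2" 1] u by simp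
  have "v powr p - u powr p - p * u powr (p - 1) * (v - u) \<le> p * (p - 1) / 2 * \<rho> powr (p - 2) * (v - u)\<^sup>2"
    using powr_tangent_remainder_ge_2[of p u v \<rho>] p u by simp
  moreover have "1 * u powr (p - 2) \<le> (p - 1) * \<rho> powr (p - 2)"
    using p u by (intro mult_mono powr_mono2) auto
  then have "u powr (p - 2) * (p * m) \<le> (p - 1) * \<rho> powr (p - 2) * (p * m)"
    using p m by (intro mult_right_mono) auto
  ultimately have "v powr p - u powr p - p * u powr (p - 1) * (v - u) + p * u powr (p - 2) * m
      \<le> p * (p - 1) / 2 * \<rho> powr (p - 2) * (norm h)\<^sup>2"
    unfolding h by (simp add: field_simps)
  moreover have "v powr p - u powr p - p * u powr (p - 1) * (v - u) + p * u powr (p - 2) * m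
     = v powr p - u powr p - p * u powr (p - 2) * inner z h"
    unfolding up defs(4) by (simp add: algebra_simps)
  ultimately show ?thesis by (simp add: powr_norm_remainder_def defs)
qed

lemma powr_norm_square: "norm x powr p = ((norm x)\<^sup>2) powr (p / 2)"
proof (cases "x = 0")
  case False
  then show ?thesis by (simp add: powr_powr flip: powr_numeral)
qed simp

lemma powr_norm_square_minus: "x \<noteq> 0 \<Longrightarrow> norm x powr (p - 2) = ((norm x)\<^sup>2) powr (p / 2 - 1)"
  by (simp add: powr_powr algebra_simps flip: powr_numeral)

lemma power2_norm_add:
  fixes z h :: "'a::real_inner"
  shows "(norm (z + h))\<^sup>2 - (norm z)\<^sup>2 = 2 * inner z h + (norm h)\<^sup>2"
  by (simp add: power2_norm_eq_inner inner_add algebra_simps inner_commute)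

text \<open>In terms of the squared norm the power is \<open>s powr (p / 2)\<close>, convex for
  \<open>p \<ge> 2\<close>. Its tangent inequality at \<open>(norm z)\<^sup>2\<close>, combined with
  \<open>power2_norm_add\<close>, yields the gradient term and a quadratic gain.\<close>

lemma powr_norm_remainder_lower_ge_2:
  fixes z h :: "'a::real_inner"
  assumes p: "2 \<le> p"
  shows "p / 2 * norm z powr (p - 2) * (norm h)\<^sup>2 \<le> powr_norm_remainder p z h"
proof (cases "z = 0")
  case False
  have "(norm z)\<^sup>2 powr (p/2) + p/2 * (norm z)\<^sup>2 powr (p/2 - 1) * ((norm (z + h))\<^sup>2 - (norm z)\<^sup>2)
      \<le> (norm (z + h))\<^sup>2 powr (p/2)"
    using p False by (intro powr_ge_tangent) auto
  then show ?thesis unfolding powr_norm_remainder_def power2_norm_add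
    by (simp add: powr_norm_square[symmetric] powr_norm_square_minus[OF False, symmetric] field_simps)
qed simp

text \<open>Here \<open>s powr (p / 2)\<close> is concave, so the tangent inequality reverses. At
  \<open>z = 0\<close> the right side would vanish through \<open>0 powr (p - 2) = 0\<close>, hence
  the assumption \<open>z \<noteq> 0\<close>.\<close>

lemma powr_norm_remainder_upper_smooth:
  fixes z h :: "'a::real_inner"
  assumes p: "0 \<le> p" "p \<le> 2" and z: "z \<noteq> 0"
  shows "powr_norm_remainder p z h \<le> p / 2 * norm z powr (p - 2) * (norm h)\<^sup>2"
proof -
  have "(norm (z + h))\<^sup>2 powr (p/2) \<le>
     (norm z)\<^sup>2 powr (p/2) + p/2 * (norm z)\<^sup>2 powr (p/2 - 1) * ((norm (z + h))\<^sup>2 - (norm z)\<^sup>2)"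
    using p z by (intro powr_le_tangent) auto
  then show ?thesis unfolding powr_norm_remainder_def power2_norm_add
    by (simp add: powr_norm_square[symmetric] powr_norm_square_minus[OF z, symmetric] field_simps)
qed

lemma powr_superadditive:
  fixes a b q :: real
  assumes "1 \<le> q" "0 \<le> a" "0 \<le> b"
  shows "a powr q + b powr q \<le> (a + b) powr q"
proof -
  have split: "x powr q = x * x powr (q - 1)" if "0 \<le> x" for x
  proof (cases "x = 0")
    case False
    then show ?thesis using powr_add[of x 1 "q - 1"] that by simp
  qed simp
  have "a * a powr (q - 1) + b * b powr (q - 1) \<le> a * (a + b) powr (q - 1) + b * (a + b) powr (q - 1)"
    using assms by (intro add_mono mult_left_mono powr_mono2) auto
  then show ?thesis using split[of a] split[of b] split[of "a + b"] assms by (simp add: algebra_simps)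
qed

text \<open>The parallelogram law compares \<open>\<parallel>z + h\<parallel>\<^sup>p + \<parallel>z\<parallel>\<^sup>p\<close> with the midpoint \<open>w\<close>, where superadditivity of
  \<open>t powr (p / 2)\<close> produces the term \<open>\<parallel>h / 2\<parallel>\<^sup>p\<close>.\<close>

lemma powr_norm_remainder_lower_powr:
  fixes z h :: "'a::real_inner"
  assumes p: "2 \<le> p"
  shows "2 powr (1 - p) * norm h powr p \<le> powr_norm_remainder p z h"
proof (cases "h = 0")
  case False
  define w k where "w = z + h /\<^sub>R 2" "k = h /\<^sub>R 2"
  define S where "S = (norm w)\<^sup>2 + (norm k)\<^sup>2"
  have S: "0 < S" using False by (auto simp: S_def w_k_def intro!: add_nonneg_pos)
  have k: "norm k = norm h / 2" by (simp add: w_k_def)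
  have par: "(norm (z + h))\<^sup>2 + (norm z)\<^sup>2 = 2 * S"
    by (simp add: S_def w_k_def power2_norm_eq_inner inner_add inner_diff inner_commute field_simps)
  have *: "S powr (p/2) + p/2 * S powr (p/2 - 1) * ((norm x)\<^sup>2 - S) \<le> norm x powr p" for x :: 'a
    unfolding powr_norm_square[of x] using p S by (intro powr_ge_tangent) auto
  \<comment> \<open>Adding the tangent inequalities at \<open>S\<close> for both endpoints cancels
    the linear terms, since the parallelogram law makes \<open>S\<close> the mean of the two squared
    norms.\<close>
  have "2 * S powr (p/2) + p/2 * S powr (p/2 - 1) * ((norm (z + h))\<^sup>2 + (norm z)\<^sup>2 - 2 * S)
      \<le> norm (z + h) powr p + norm z powr p"
    using *[of "z + h"] *[of z] by (simp add: field_simps)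
  then have 1: "2 * S powr (p/2) \<le> norm (z + h) powr p + norm z powr p" unfolding par by simp
  have "norm w powr p + norm k powr p \<le> S powr (p/2)"
    unfolding S_def powr_norm_square[of w] powr_norm_square[of k] using p by (intro powr_superadditive) auto
  \<comment> \<open>The gradient inequality at \<open>z\<close> in the direction \<open>k\<close>
    carries half of the gradient term; the factor \<open>2\<close> in front of
    \<open>S powr (p/2)\<close> restores it in full.\<close>
  moreover have "0 \<le> powr_norm_remainder p z k"
    by (rule order_trans[OF _ powr_norm_remainder_lower_ge_2]) (use p in auto)
  then have "norm z powr p + p / 2 * norm z powr (p - 2) * inner z h \<le> norm w powr p"
    by (simp add: powr_norm_remainder_def w_k_def)
  moreover have "2 powr (1 - p) * norm h powr p = 2 * norm k powr p"
    by (simp add: k powr_divide powr_diff)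
  ultimately show ?thesis using 1 by (simp add: powr_norm_remainder_def)
qed (simp add: powr_norm_remainder_def)

text \<open>For \<open>norm h \<le> norm z\<close> the concavity bound applies. For larger
  \<open>h\<close> the power and the gradient term are bounded separately by \<open>2 powr p\<close>
  and \<open>p\<close> times \<open>norm h powr p\<close>. In both cases the larger norm is within a
  factor two of \<open>norm z + norm h\<close>, which costs \<open>2 powr (2 - p)\<close>.\<close>

lemma powr_norm_remainder_upper_le_2:
  fixes z h :: "'a::real_inner"
  assumes p: "1 < p" "p \<le> 2"
  shows "powr_norm_remainder p z h \<le>
    2 powr (2 - p) * (2 powr p + p) * (norm z + norm h) powr (p - 2) * (norm h)\<^sup>2"
proof -
  let ?\<rho> = "norm z + norm h"
  have cmp: "x powr (p - 2) \<le> 2 powr (2 - p) * ?\<rho> powr (p - 2)" if "0 < x" "0 < ?\<rho>" "?\<rho> \<le> 2 * x" for x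
  proof -
    have "(2 * x) powr (p - 2) \<le> ?\<rho> powr (p - 2)"
      using that p by (intro powr_mono2') auto
    then have "2 powr (2 - p) * ((2 * x) powr (p - 2)) \<le> 2 powr (2 - p) * ?\<rho> powr (p - 2)"
      by (intro mult_left_mono) auto
    moreover have "2 powr (2 - p) * ((2 * x) powr (p - 2)) = x powr (p - 2)"
      using that by (simp add: powr_mult powr_add[symmetric] mult.assoc[symmetric])
    ultimately show ?thesis by simp
  qed
  consider "z = 0" "h = 0" | "z \<noteq> 0" "norm h \<le> norm z" | "norm z < norm h" "h \<noteq> 0" by fastforce
  then show ?thesis
  proof cases
    case 1
    then show ?thesis by simp
  next
    case 2
    have \<rho>: "0 < ?\<rho>" using 2 by (simp add: add_pos_nonneg)
    have "p / 2 * norm z powr (p - 2) \<le> (2 powr p + p) * (2 powr (2 - p) * ?\<rho> powr (p - 2))"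
      using p cmp[OF _ \<rho>, of "norm z"] 2 by (intro mult_mono) (auto simp: add_increasing)
    then have "p / 2 * norm z powr (p - 2) * (norm h)\<^sup>2 \<le>
        (2 powr p + p) * (2 powr (2 - p) * ?\<rho> powr (p - 2)) * (norm h)\<^sup>2"
      by (rule mult_right_mono) simp
    then show ?thesis using powr_norm_remainder_upper_smooth[of p z h] 2 p
      by (simp add: mult_ac)
  next
    case 3
    have \<rho>: "0 < ?\<rho>" using 3 by (simp add: add_nonneg_pos)
    have "norm (z + h) powr p \<le> (2 * norm h) powr p"
      using 3 p norm_triangle_ineq[of z h] by (intro powr_mono2) auto
    moreover have "- (norm z powr (p - 2) * inner z h) \<le> norm h powr p"
    proof (cases "z = 0")
      case False
      have "- (norm z powr (p - 2) * inner z h) \<le> norm z powr (p - 2) * \<bar>inner z h\<bar>"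
        by (metis abs_ge_minus_self abs_mult abs_of_nonneg powr_ge_zero)
      also have "\<dots> \<le> norm z powr (p - 2) * (norm z * norm h)"
        by (intro mult_left_mono Cauchy_Schwarz_ineq2) auto
      also have "\<dots> = norm z powr (p - 1) * norm h"
        using powr_add[of "norm z" "p - 2" 1] False by simp
      also have "\<dots> \<le> norm h powr (p - 1) * norm h"
        using 3 p by (intro mult_right_mono powr_mono2) auto
      also have "\<dots> = norm h powr p"
        using powr_add[of "norm h" "p - 1" 1] 3 by simp
      finally show ?thesis .
    qed auto
    then have "p * - (norm z powr (p - 2) * inner z h) \<le> p * norm h powr p"
      using p by (intro mult_left_mono) auto
    ultimately have "powr_norm_remainder p z h \<le> (2 powr p + p) * norm h powr p"
      by (simp add: powr_norm_remainder_def powr_mult algebra_simps add_increasing)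
    also have "\<dots> = (2 powr p + p) * (norm h powr (p - 2)) * (norm h)\<^sup>2"
      using powr_square_split[of "norm h" p] by simp
    also have "\<dots> \<le> (2 powr p + p) * (2 powr (2 - p) * ?\<rho> powr (p - 2)) * (norm h)\<^sup>2"
      using p cmp[OF _ \<rho>, of "norm h"] 3 by (intro mult_mono) (auto simp: add_nonneg_nonneg)
    finally show ?thesis by (simp add: mult_ac)
  qed
qed

section \<open>The potential\<close>

lemma nn_integral_powr_layer:
  fixes p t :: real
  assumes p: "1 < p" and t: "0 \<le> t"
  shows "(\<integral>\<^sup>+a. ennreal (a powr (p - 2) * max 0 (t - a)) * indicator {0<..} a \<partial>lborel) =
    ennreal (t powr p / (p * (p - 1)))"
proof -
  let ?F = "\<lambda>a. t * a powr (p - 1) / (p - 1) - a powr p / p"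
  let ?f = "\<lambda>a. a powr (p - 2) * max 0 (t - a)"
  \<comment> \<open>For \<open>p < 2\<close> the weight is singular at \<open>0\<close>, so
    differentiability is used only inside the interval, together with continuity of
    \<open>?F\<close> up to the endpoints.\<close>
  have "(?f has_integral (?F t - ?F 0)) {0..t}"
  proof (rule fundamental_theorem_of_calculus_interior[OF t])
    show "continuous_on {0..t} ?F"
      using p by (intro continuous_intros continuous_on_powr') auto
    fix a assume a: "a \<in> {0<..<t}"
    have "a powr (p - 1) = a powr (p - 2) * a" using a powr_add[of a "p - 2" 1] by simp
    have "(?F has_real_derivative t * ((p - 1) * a powr (p - 1 - 1)) / (p - 1) - p * a powr (p - 1) / p) (at a)"
      using a p by (auto intro!: derivative_eq_intros)
    moreover have "t * ((p - 1) * a powr (p - 1 - 1)) / (p - 1) - p * a powr (p - 1) / p = ?f a"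
      unfolding \<open>a powr (p - 1) = _\<close> using a p by (simp add: field_simps)
    ultimately show "(?F has_vector_derivative ?f a) (at a)"
      unfolding has_real_derivative_iff_has_vector_derivative by simp
  qed
  moreover have "?F t - ?F 0 = t powr p / (p * (p - 1))"
  proof (cases "t = 0")
    case False
    have "t * t powr (p - 1) = t powr p" using t False powr_add[of t 1 "p - 1"] by simp
    then show ?thesis using p by (simp add: field_simps)
  qed simp
  ultimately have "((\<lambda>a. if a \<in> {0..t} then ?f a else 0) has_integral t powr p / (p * (p - 1))) UNIV"
    by (simp only: has_integral_restrict_UNIV)
  moreover have "(\<lambda>a. if a \<in> {0..t} then ?f a else 0) = (\<lambda>a. ?f a * indicator {0<..} a)"
    using t by (auto simp: fun_eq_iff indicator_def)
  ultimately have "((\<lambda>a. ?f a * indicator {0<..} a) has_integral t powr p / (p * (p - 1))) UNIV" by simp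
  then have "(\<integral>\<^sup>+a. ennreal (?f a * indicator {0<..} a) \<partial>lborel) = ennreal (t powr p / (p * (p - 1)))"
    by (intro nn_integral_has_integral_lborel) auto
  then show ?thesis by (simp add: ennreal_mult' ennreal_indicator)
qed

text \<open>For a nonnegative weight this is, where finite, the even convex function of
  \<open>t\<close> with value and slope \<open>0\<close> at the origin and second derivative
  \<open>w r\<close>, written as a superposition of the excess functions
  \<open>max 0 (\<bar>t\<bar> - a)\<close>. Values in \<open>ennreal\<close> avoid integrability
  conditions.\<close>

definition layer_integral :: "(real \<Rightarrow> real \<Rightarrow> real) \<Rightarrow> real \<Rightarrow> real \<Rightarrow> ennreal" where
  "layer_integral w r t = (\<integral>\<^sup>+a. ennreal (w r a * max 0 (\<bar>t\<bar> - a)) * indicator {0<..} a \<partial>lborel)"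

lemma nn_integral_layer:
  "(\<integral>\<^sup>+a. ennreal (max 0 (\<bar>t\<bar> - a)) * indicator {0<..} a \<partial>lborel) = ennreal (t\<^sup>2 / 2)"
proof -
  have "(\<integral>\<^sup>+a. ennreal (max 0 (\<bar>t\<bar> - a)) * indicator {0<..} a \<partial>lborel)
    = (\<integral>\<^sup>+a. ennreal (a powr (2 - 2) * max 0 (\<bar>t\<bar> - a)) * indicator {0<..} a \<partial>lborel)"
    by (intro nn_integral_cong) (auto simp: indicator_def)
  also have "\<dots> = ennreal (\<bar>t\<bar> powr 2 / (2 * (2 - 1)))" by (rule nn_integral_powr_layer) auto
  finally show ?thesis by (simp add: powr_numeral)
qed

text \<open>Levels above \<open>\<bar>t\<bar>\<close> contribute nothing, so the weights need
  comparing only below it. This admits comparison weights that depend on \<open>t\<close>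
  itself.\<close>

lemma layer_integral_mono:
  assumes "\<And>a. 0 < a \<Longrightarrow> a < \<bar>t\<bar> \<Longrightarrow> v r a \<le> w r a"
  shows "layer_integral v r t \<le> layer_integral w r t"
  unfolding layer_integral_def
proof (intro nn_integral_mono)
  fix a
  have "v r a * max 0 (\<bar>t\<bar> - a) \<le> w r a * max 0 (\<bar>t\<bar> - a)" if "0 < a"
    using assms[of a] that by (cases "a < \<bar>t\<bar>") (auto intro: mult_right_mono)
  then show "ennreal (v r a * max 0 (\<bar>t\<bar> - a)) * indicator {0<..} a
      \<le> ennreal (w r a * max 0 (\<bar>t\<bar> - a)) * indicator {0<..} a"
    by (auto simp: indicator_def intro!: ennreal_leI)
qed

lemma layer_integral_const:
  assumes "0 \<le> k" shows "layer_integral (\<lambda>r a. k) r t = ennreal (k * (t\<^sup>2 / 2))"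
proof -
  have "layer_integral (\<lambda>r a. k) r t = (\<integral>\<^sup>+a. ennreal k * (ennreal (max 0 (\<bar>t\<bar> - a)) * indicator {0<..} a) \<partial>lborel)"
    using assms by (simp add: layer_integral_def ennreal_mult' mult.assoc)
  also have "\<dots> = ennreal k * ennreal (t\<^sup>2 / 2)"
    by (subst nn_integral_cmult) (auto simp only: nn_integral_layer, measurable)
  finally show ?thesis using assms by (simp only: ennreal_mult'[symmetric])
qed

lemma layer_integral_powr:
  assumes "0 \<le> k" "1 < p"
  shows "layer_integral (\<lambda>r a. k * a powr (p - 2)) r t = ennreal (k * (\<bar>t\<bar> powr p / (p * (p - 1))))"
proof -
  have "layer_integral (\<lambda>r a. k * a powr (p - 2)) r t
    = (\<integral>\<^sup>+a. ennreal k * (ennreal (a powr (p - 2) * max 0 (\<bar>t\<bar> - a)) * indicator {0<..} a) \<partial>lborel)"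
    unfolding layer_integral_def using assms by (simp add: ennreal_mult'[symmetric] mult.assoc[symmetric])
  also have "\<dots> = ennreal k * ennreal (\<bar>t\<bar> powr p / (p * (p - 1)))"
    using assms(2) by (subst nn_integral_cmult) (auto simp only: nn_integral_powr_layer abs_ge_zero, measurable)
  finally show ?thesis using assms by (simp only: ennreal_mult'[symmetric])
qed

text \<open>The potential \<open>U\<close> is evaluated at \<open>(L \<Sum>d, \<Sum>e)\<close>. In one step it can increase only by
  \<open>A \<Psi>(e) - C \<Psi>(L d)\<close>, and this has nonpositive mean as soon as \<open>e\<close> is majorized by \<open>d\<close> and \<open>L\<close> is
  large, because \<open>\<Psi>\<close> is equivalent to the convex function with second derivative \<open>w\<close>.\<close>

locale martingale_potential =
  fixes p :: real and U :: "real \<times> real \<Rightarrow> real" and g :: "real \<times> real \<Rightarrow> real \<times> real"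
    and \<Psi> w :: "real \<Rightarrow> real \<Rightarrow> real" and A B C D L :: real
  assumes p: "1 < p"
    and params: "0 \<le> A" "0 \<le> B" "0 \<le> C" "0 < L"
    and U_measurable [measurable]: "U \<in> borel_measurable borel"
    and g_measurable [measurable]: "g \<in> borel_measurable borel"
    and \<Psi>_measurable: "case_prod \<Psi> \<in> borel_measurable (borel \<Otimes>\<^sub>M borel)"
    and w_measurable: "case_prod w \<in> borel_measurable (borel \<Otimes>\<^sub>M borel)"
    and U_0: "U 0 \<le> 0"
    and U_bound: "\<And>z. \<bar>U z\<bar> \<le> D * norm z powr p"
    and g_bound: "\<And>z. norm (g z) \<le> D * norm z powr (p - 1)"
    and \<Psi>_nonneg: "\<And>r t. 0 \<le> \<Psi> r t"
    and \<Psi>_bound: "\<And>r t. 0 \<le> r \<Longrightarrow> \<Psi> r t \<le> D * (r + \<bar>t\<bar>) powr p"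
    and U_lower: "\<And>x y. \<bar>y\<bar> powr p \<le> U (x, y) + D * \<bar>x\<bar> powr p"
    and U_step: "\<And>z h. U (z + h) \<le> U z + inner (g z) h + A * \<Psi> (norm z) (snd h) - C * \<Psi> (norm z) (fst h)"
    and w_nonneg: "\<And>r a. 0 \<le> r \<Longrightarrow> 0 < a \<Longrightarrow> 0 \<le> w r a"
    and \<Psi>_le_layer: "\<And>r t. 0 \<le> r \<Longrightarrow> ennreal (\<Psi> r t) \<le> layer_integral w r t"
    and layer_le_\<Psi>: "\<And>r t. 0 \<le> r \<Longrightarrow> layer_integral w r t \<le> ennreal (B * \<Psi> r t)"
    and \<Psi>_scale: "\<And>r t. 0 \<le> r \<Longrightarrow> A * B * \<Psi> r t \<le> C * \<Psi> r (L * t)"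

section \<open>The power potential and its elementary bounds\<close>

text \<open>For small \<open>\<epsilon>\<close> the potential \<open>(2\<^sup>p + 1) (\<epsilon>\<^sup>2 x\<^sup>2 + y\<^sup>2)\<^sup>p\<^sup>/\<^sup>2 - (x\<^sup>2 + y\<^sup>2)\<^sup>p\<^sup>/\<^sup>2\<close> is uniformly concave
  in \<open>x\<close>. For \<open>p \<ge> 2\<close> one may take \<open>\<epsilon> = 0\<close>; for \<open>p < 2\<close> a positive \<open>\<epsilon>\<close> removes the singularity
  of the second derivative of \<open>\<bar>y\<bar>\<^sup>p\<close> at \<open>y = 0\<close>.\<close>

definition stretch :: "real \<Rightarrow> real \<times> real \<Rightarrow> real \<times> real" where
  "stretch \<epsilon> z = (\<epsilon> * fst z, snd z)"

definition power_potential :: "real \<Rightarrow> real \<Rightarrow> real \<times> real \<Rightarrow> real" where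
  "power_potential p \<epsilon> z = (2 powr p + 1) * norm (stretch \<epsilon> z) powr p - norm z powr p"

text \<open>The double \<open>stretch\<close> arises because the gradient of
  \<open>norm (stretch \<epsilon> z) powr p\<close> involves the adjoint of the diagonal map
  \<open>stretch \<epsilon>\<close>, which is that map itself.\<close>

definition power_potential_grad :: "real \<Rightarrow> real \<Rightarrow> real \<times> real \<Rightarrow> real \<times> real" where
  "power_potential_grad p \<epsilon> z =
     ((2 powr p + 1) * p * norm (stretch \<epsilon> z) powr (p - 2)) *\<^sub>R stretch \<epsilon> (stretch \<epsilon> z)
     - (p * norm z powr (p - 2)) *\<^sub>R z"

lemma stretch_measurable [measurable]: "stretch \<epsilon> \<in> borel_measurable borel"
  unfolding stretch_def by (intro borel_measurable_continuous_onI continuous_intros)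

lemma power_potential_measurable [measurable]:
  "power_potential p \<epsilon> \<in> borel_measurable borel" "power_potential_grad p \<epsilon> \<in> borel_measurable borel"
  unfolding power_potential_def power_potential_grad_def by measurable

lemma norm_stretch_le:
  assumes "0 \<le> \<epsilon>" "\<epsilon> \<le> 1" shows "norm (stretch \<epsilon> z) \<le> norm z"
proof -
  have "(\<epsilon> * fst z)\<^sup>2 \<le> (fst z)\<^sup>2"
    using assms by (simp add: power_mult_distrib mult_left_le_one_le power_le_one)
  then show ?thesis by (cases z) (simp add: stretch_def norm_prod_def)
qed

lemma norm_stretch_ge:
  assumes "0 \<le> \<epsilon>" "\<epsilon> \<le> 1" shows "\<epsilon> * norm z \<le> norm (stretch \<epsilon> z)"
proof -
  have "\<epsilon>\<^sup>2 * (snd z)\<^sup>2 \<le> (snd z)\<^sup>2" using assms by (simp add: mult_left_le_one_le power_le_one)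
  then have "sqrt (\<epsilon>\<^sup>2 * ((fst z)\<^sup>2 + (snd z)\<^sup>2)) \<le> sqrt ((\<epsilon> * fst z)\<^sup>2 + (snd z)\<^sup>2)"
    by (simp add: power_mult_distrib distrib_left)
  then show ?thesis using assms by (cases z) (simp add: stretch_def norm_prod_def real_sqrt_mult)
qed

lemma abs_le_norm_pair: "\<bar>fst z\<bar> \<le> norm z" "\<bar>snd z\<bar> \<le> norm z" for z :: "real \<times> real"
  using norm_fst_le[of "fst z" "snd z"] norm_snd_le[of "snd z" "fst z"] by auto

lemma powr_minus_two_times: "(x::real) \<ge> 0 \<Longrightarrow> x powr (p - 2) * x = x powr (p - 1)"
  using powr_add[of x "p - 2" 1] by (cases "x = 0") auto

lemma powr_sum_le:
  fixes a b p :: real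
  assumes "0 \<le> p" "0 \<le> a" "0 \<le> b"
  shows "(a + b) powr p \<le> 2 powr p * (a powr p + b powr p)"
proof -
  have "(a + b) powr p \<le> (2 * max a b) powr p" using assms by (intro powr_mono2) auto
  also have "\<dots> = 2 powr p * (max a b) powr p" using assms by (simp add: powr_mult)
  also have "\<dots> \<le> 2 powr p * (a powr p + b powr p)" by (intro mult_left_mono) (auto simp: max_def)
  finally show ?thesis .
qed

lemma power_potential_bound:
  assumes "1 < p" "0 \<le> \<epsilon>" "\<epsilon> \<le> 1"
  shows "\<bar>power_potential p \<epsilon> z\<bar> \<le> (2 powr p + 2) * norm z powr p"
proof -
  have *: "norm (stretch \<epsilon> z) powr p \<le> norm z powr p"
    using assms by (intro powr_mono2 norm_stretch_le) auto
  have "\<bar>power_potential p \<epsilon> z\<bar> \<le> (2 powr p + 1) * norm (stretch \<epsilon> z) powr p + norm z powr p"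
    unfolding power_potential_def by (intro order_trans[OF abs_triangle_ineq4]) auto
  also have "\<dots> \<le> (2 powr p + 1) * norm z powr p + norm z powr p"
    using * by (intro add_mono mult_left_mono) auto
  finally show ?thesis by (simp add: algebra_simps)
qed

lemma power_potential_grad_bound:
  assumes "1 < p" "0 \<le> \<epsilon>" "\<epsilon> \<le> 1"
  shows "norm (power_potential_grad p \<epsilon> z) \<le> p * (2 powr p + 2) * norm z powr (p - 1)"
proof -
  let ?s = "stretch \<epsilon> z"
  have "norm ?s powr (p - 2) * norm (stretch \<epsilon> ?s) \<le> norm ?s powr (p - 2) * norm ?s"
    using assms by (intro mult_left_mono norm_stretch_le) auto
  also have "\<dots> \<le> norm z powr (p - 1)"
    using assms by (auto simp: powr_minus_two_times intro!: powr_mono2 norm_stretch_le)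
  finally have *: "(2 powr p + 1) * p * (norm ?s powr (p - 2) * norm (stretch \<epsilon> ?s))
      \<le> (2 powr p + 1) * p * norm z powr (p - 1)"
    using assms by (intro mult_left_mono) auto
  have "norm (power_potential_grad p \<epsilon> z)
      \<le> (2 powr p + 1) * p * (norm ?s powr (p - 2) * norm (stretch \<epsilon> ?s)) + p * (norm z powr (p - 2) * norm z)"
    unfolding power_potential_grad_def using assms
    by (intro order_trans[OF norm_triangle_ineq4]) (simp add: abs_mult)
  also have "\<dots> \<le> (2 powr p + 1) * p * norm z powr (p - 1) + p * norm z powr (p - 1)"
    using * by (simp add: powr_minus_two_times)
  finally show ?thesis by (simp add: algebra_simps)
qed

text \<open>This is the source of the coefficient \<open>2 powr p + 1\<close>: stretching leaves
  \<open>y\<close> intact, and after \<open>norm (x, y) powr p\<close> has consumed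
  \<open>2 powr p * \<bar>y\<bar> powr p\<close>, one copy of \<open>\<bar>y\<bar> powr p\<close>
  remains.\<close>

lemma power_potential_lower:
  assumes "1 < p" "0 \<le> \<epsilon>" "\<epsilon> \<le> 1"
  shows "\<bar>y\<bar> powr p \<le> power_potential p \<epsilon> (x, y) + 2 powr p * \<bar>x\<bar> powr p"
proof -
  have "norm (x, y) powr p \<le> (\<bar>x\<bar> + \<bar>y\<bar>) powr p"
    using assms norm_Pair_le[of x y] by (intro powr_mono2) auto
  also have "\<dots> \<le> 2 powr p * (\<bar>x\<bar> powr p + \<bar>y\<bar> powr p)" using assms by (intro powr_sum_le) auto
  finally have 1: "norm (x, y) powr p \<le> 2 powr p * (\<bar>x\<bar> powr p + \<bar>y\<bar> powr p)" .
  have "\<bar>y\<bar> powr p \<le> norm (stretch \<epsilon> (x, y)) powr p"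
    using assms abs_le_norm_pair(2)[of "stretch \<epsilon> (x, y)"] by (intro powr_mono2) (auto simp: stretch_def)
  then have "(2 powr p + 1) * \<bar>y\<bar> powr p \<le> (2 powr p + 1) * norm (stretch \<epsilon> (x, y)) powr p"
    by (intro mult_left_mono) auto
  with 1 show ?thesis unfolding power_potential_def by (simp add: algebra_simps)
qed

lemma stretch_add: "stretch \<epsilon> (z + h) = stretch \<epsilon> z + stretch \<epsilon> h"
  by (simp add: stretch_def algebra_simps)

text \<open>The linear parts match because \<open>stretch \<epsilon>\<close> is self-adjoint. Of the
  two remainders the stretched one has to be bounded above and the other below; the latter supplies
  the concavity in the first coordinate.\<close>

lemma power_potential_expand:
  "power_potential p \<epsilon> (z + h) = power_potential p \<epsilon> z + inner (power_potential_grad p \<epsilon> z) h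
     + (2 powr p + 1) * powr_norm_remainder p (stretch \<epsilon> z) (stretch \<epsilon> h) - powr_norm_remainder p z h"
proof -
  have "inner (stretch \<epsilon> (stretch \<epsilon> z)) h = inner (stretch \<epsilon> z) (stretch \<epsilon> h)"
    by (cases z; cases h) (simp add: stretch_def)
  then show ?thesis
    by (simp add: power_potential_def power_potential_grad_def powr_norm_remainder_def stretch_add
        inner_diff_left algebra_simps)
qed

section \<open>Choice of the parameters in the two ranges of the exponent\<close>

lemma exists_scale:
  fixes K c p :: real
  assumes "0 < c" "0 \<le> K"
  shows "\<exists>L\<ge>1. K \<le> c * L"
  using assms by (intro exI[of _ "max 1 (K / c)"]) (auto simp: max_def field_simps)

lemma powr_ge_self: "1 \<le> (L::real) \<Longrightarrow> 1 \<le> p \<Longrightarrow> L \<le> L powr p"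
  using powr_mono[of 1 p L] by simp

text \<open>With \<open>\<epsilon> = 0\<close> the stretch discards the first coordinate, so the
  positive remainder sees only \<open>e\<close>, while the negative one controls \<open>d\<close>.
  Here \<open>\<Psi>\<close> is itself convex in \<open>t\<close> with second derivative
  \<open>w r \<bar>t\<bar>\<close>, which allows \<open>B = 1\<close>.\<close>

lemma exists_potential_ge_2:
  assumes p: "2 \<le> p"
  shows "\<exists>U g \<Psi> w A B C D L. martingale_potential p U g \<Psi> w A B C D L"
proof -
  define \<Psi> where "\<Psi> r t = r powr (p - 2) * t\<^sup>2 + \<bar>t\<bar> powr p" for r t :: real
  define w where "w r a = 2 * r powr (p - 2) + p * (p - 1) * a powr (p - 2)" for r a :: real
  define M where "M = 2 powr p + (1::real)"
  \<comment> \<open>The factor \<open>p * (p - 1) / 2\<close> comes from the upper remainder bound,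
    and \<open>2 powr (p - 2)\<close> from splitting \<open>(r + \<bar>e\<bar>) powr (p - 2)\<close>
    into the two terms of \<open>\<Psi>\<close>.\<close>
  define A where "A = M * (p * (p - 1) / 2) * 2 powr (p - 2)"
  \<comment> \<open>Half of \<open>2 powr (1 - p)\<close>: both terms of \<open>\<Psi>\<close> are
    bounded by the same remainder, which is therefore counted twice.\<close>
  define C where "C = 2 powr (- p)"
  define D where "D = p * (2 powr p + 2)"
  have M: "0 \<le> M" by (simp add: M_def)
  have A: "0 \<le> A" using p M by (simp add: A_def)
  have "1 * (2 powr p + 2) \<le> D" unfolding D_def using p by (intro mult_right_mono) auto
  then have D1: "2 powr p + 2 \<le> D" by simp
  moreover have "0 \<le> 2 powr p" by simp
  ultimately have D2: "2 powr p \<le> D" and D3: "2 \<le> D" by linarith+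
  note D = D1 D2 D3
  obtain L where L: "1 \<le> L" "A * 1 \<le> C * L" using exists_scale[of C "A * 1"] A by (auto simp: C_def)
  have layer: "layer_integral w r t = ennreal (\<Psi> r t)" if r: "0 \<le> r" for r t
  proof -
    have "layer_integral w r t = (\<integral>\<^sup>+a. ennreal (2 * r powr (p - 2)) * (ennreal (max 0 (\<bar>t\<bar> - a)) * indicator {0<..} a)
      + ennreal (p * (p - 1)) * (ennreal (a powr (p - 2) * max 0 (\<bar>t\<bar> - a)) * indicator {0<..} a) \<partial>lborel)"
    proof -
      have split: "ennreal ((c + k * q) * m) = ennreal c * ennreal m + ennreal k * ennreal (q * m)"
        if "0 \<le> c" "0 \<le> k" "0 \<le> q" "0 \<le> m" for c k q m
        using that by (simp add: ennreal_mult[symmetric] ennreal_plus[symmetric] distrib_right mult.assoc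
            del: ennreal_plus)
      show ?thesis unfolding layer_integral_def w_def using p
        by (intro nn_integral_cong) (subst split; simp add: distrib_right mult.assoc)
    qed
    also have "\<dots> = ennreal (2 * r powr (p - 2)) * ennreal (t\<^sup>2 / 2) + ennreal (p * (p - 1)) * ennreal (\<bar>t\<bar> powr p / (p * (p - 1)))"
      using nn_integral_powr_layer[of p "\<bar>t\<bar>"] nn_integral_layer[of t] p by (simp add: nn_integral_add nn_integral_cmult)
    also have "\<dots> = ennreal (\<Psi> r t)"
      unfolding \<Psi>_def using p by (simp add: ennreal_mult'[symmetric] ennreal_plus[symmetric] del: ennreal_plus)
    finally show ?thesis .
  qed
  have "martingale_potential p (power_potential p 0) (power_potential_grad p 0) \<Psi> w A 1 C D L"
  proof
    fix r t x y :: real and z h :: "real \<times> real"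
    show "1 < p" "0 \<le> A" "(0::real) \<le> 1" "0 \<le> C" "0 < L" using p A L by (auto simp: C_def)
    show "power_potential p 0 \<in> borel_measurable borel" "power_potential_grad p 0 \<in> borel_measurable borel"
      by simp_all
    show "case_prod \<Psi> \<in> borel_measurable (borel \<Otimes>\<^sub>M borel)" unfolding \<Psi>_def by measurable
    show "case_prod w \<in> borel_measurable (borel \<Otimes>\<^sub>M borel)" unfolding w_def by measurable
    show "power_potential p 0 0 \<le> 0" by (simp add: power_potential_def stretch_def zero_prod_def)
    have "(2 powr p + 2) * norm z powr p \<le> D * norm z powr p" using D by (intro mult_right_mono) auto
    then show "\<bar>power_potential p 0 z\<bar> \<le> D * norm z powr p"
      using power_potential_bound[of p 0 z] p by linarith
    show "norm (power_potential_grad p 0 z) \<le> D * norm z powr (p - 1)"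
      using power_potential_grad_bound[of p 0 z] p by (simp add: D_def)
    show \<Psi>0: "0 \<le> \<Psi> r t" for r t by (simp add: \<Psi>_def)
    show "\<Psi> r t \<le> D * (r + \<bar>t\<bar>) powr p" if r: "0 \<le> r"
    proof -
      have "r powr (p - 2) * t\<^sup>2 \<le> (r + \<bar>t\<bar>) powr (p - 2) * (r + \<bar>t\<bar>)\<^sup>2"
        using r p by (intro mult_mono powr_mono2 power2_le_iff_abs_le[THEN iffD2]) auto
      moreover have "\<dots> = (r + \<bar>t\<bar>) powr p" using r powr_square_split[of "r + \<bar>t\<bar>" p] by simp
      moreover have "\<bar>t\<bar> powr p \<le> (r + \<bar>t\<bar>) powr p" using r p by (intro powr_mono2) auto
      ultimately have "\<Psi> r t \<le> 2 * (r + \<bar>t\<bar>) powr p" by (simp add: \<Psi>_def)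
      also have "\<dots> \<le> D * (r + \<bar>t\<bar>) powr p" using D by (intro mult_right_mono) auto
      finally show ?thesis .
    qed
    have "2 powr p * \<bar>x\<bar> powr p \<le> D * \<bar>x\<bar> powr p" using D by (intro mult_right_mono) auto
    then show "\<bar>y\<bar> powr p \<le> power_potential p 0 (x, y) + D * \<bar>x\<bar> powr p"
      using power_potential_lower[of p 0 y x] p by linarith
    show "0 \<le> w r a" for a unfolding w_def using p by auto
    show "0 \<le> r \<Longrightarrow> ennreal (\<Psi> r t) \<le> layer_integral w r t" "0 \<le> r \<Longrightarrow> layer_integral w r t \<le> ennreal (1 * \<Psi> r t)"
      using layer by simp_all
    show "A * 1 * \<Psi> r t \<le> C * \<Psi> r (L * t)"
    proof -
      \<comment> \<open>The exponents \<open>2\<close> and \<open>p\<close> of \<open>t\<close> in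
        \<open>\<Psi>\<close> are at least \<open>1\<close>, so scaling \<open>t\<close> by
        \<open>L\<close> multiplies \<open>\<Psi>\<close> by at least \<open>L\<close>.\<close>
      have "L \<le> L powr p" "L \<le> L\<^sup>2" using L p powr_ge_self[of L p] self_le_power[of L 2] by auto
      then have "L * (r powr (p - 2) * t\<^sup>2) \<le> L\<^sup>2 * (r powr (p - 2) * t\<^sup>2)" "L * \<bar>t\<bar> powr p \<le> L powr p * \<bar>t\<bar> powr p"
        by (intro mult_right_mono; simp)+
      then have "L * \<Psi> r t \<le> \<Psi> r (L * t)"
        using L by (simp add: \<Psi>_def power_mult_distrib abs_mult powr_mult algebra_simps)
      then have "C * (L * \<Psi> r t) \<le> C * \<Psi> r (L * t)" by (intro mult_left_mono) (auto simp: C_def)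
      moreover have "A * \<Psi> r t \<le> C * L * \<Psi> r t" using L \<Psi>0 by (intro mult_right_mono) auto
      ultimately show ?thesis by (simp add: mult_ac)
    qed
    show "power_potential p 0 (z + h) \<le> power_potential p 0 z + power_potential_grad p 0 z \<bullet> h +
        A * \<Psi> (norm z) (snd h) - C * \<Psi> (norm z) (fst h)"
    proof -
      let ?r = "norm z"
      obtain d e where h: "h = (d, e)" by (cases h)
      have st: "norm (stretch 0 u) = \<bar>snd u\<bar>" for u by (simp add: stretch_def norm_prod_def)
      have "powr_norm_remainder p (stretch 0 z) (stretch 0 h)
          \<le> p * (p - 1) / 2 * (\<bar>snd z\<bar> + \<bar>e\<bar>) powr (p - 2) * e\<^sup>2"
        using powr_norm_remainder_upper_ge_2[OF p, of "stretch 0 z" "stretch 0 h"] by (simp add: st h)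
      also have "\<dots> \<le> p * (p - 1) / 2 * (2 powr (p - 2) * (?r powr (p - 2) + \<bar>e\<bar> powr (p - 2))) * e\<^sup>2"
      proof -
        have "(\<bar>snd z\<bar> + \<bar>e\<bar>) powr (p - 2) \<le> (?r + \<bar>e\<bar>) powr (p - 2)"
          using p abs_le_norm_pair[of z] by (intro powr_mono2) auto
        also have "\<dots> \<le> 2 powr (p - 2) * (?r powr (p - 2) + \<bar>e\<bar> powr (p - 2))"
          using p by (intro powr_sum_le) auto
        finally show ?thesis using p by (intro mult_right_mono mult_left_mono) auto
      qed
      also have "\<dots> = p * (p - 1) / 2 * 2 powr (p - 2) * \<Psi> ?r e"
        using powr_square_split[of "\<bar>e\<bar>" p] by (simp add: \<Psi>_def field_simps)
      finally have "M * powr_norm_remainder p (stretch 0 z) (stretch 0 h) \<le> A * \<Psi> ?r e"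
        unfolding A_def mult.assoc using M by (intro mult_left_mono) (auto simp: mult_ac)
      moreover have "C * \<Psi> ?r d \<le> powr_norm_remainder p z h"
      proof -
        have "2 powr (1 - p) \<le> 2 powr (0::real)" using p by (intro powr_mono) auto
        then have "2 powr (1 - p) * (?r powr (p - 2) * d\<^sup>2) \<le> p / 2 * (?r powr (p - 2) * (norm h)\<^sup>2)"
          using p abs_le_norm_pair[of h]
          by (intro mult_mono) (auto simp: h intro!: power_mono abs_le_square_iff[THEN iffD1])
        also have "\<dots> \<le> powr_norm_remainder p z h"
          using powr_norm_remainder_lower_ge_2[OF p, of z h] by (simp add: mult_ac)
        finally have 1: "2 powr (1 - p) * (?r powr (p - 2) * d\<^sup>2) \<le> powr_norm_remainder p z h" .
        have "2 powr (1 - p) * \<bar>d\<bar> powr p \<le> 2 powr (1 - p) * norm h powr p"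
          using p abs_le_norm_pair[of h] by (intro mult_left_mono powr_mono2) (auto simp: h)
        also have "\<dots> \<le> powr_norm_remainder p z h" by (rule powr_norm_remainder_lower_powr[OF p])
        finally have "2 powr (1 - p) * \<Psi> ?r d \<le> 2 * powr_norm_remainder p z h"
          using 1 by (simp add: \<Psi>_def algebra_simps)
        moreover have "2 powr (1 - p) = 2 * C" by (simp add: C_def powr_diff powr_minus field_simps)
        ultimately show ?thesis by simp
      qed
      ultimately show ?thesis unfolding power_potential_expand by (simp add: h M_def)
    qed
  qed
  then show ?thesis by blast
qed

text \<open>The weight \<open>w r a\<close> is nonincreasing in \<open>a\<close>; freezing it at
  \<open>a = \<bar>t\<bar>\<close> gives exactly \<open>\<Psi>\<close> as a lower bound for the
  layer integral, and replacing \<open>r + a\<close> by \<open>r\<close> or by \<open>a\<close>,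
  according to which of \<open>r\<close> and \<open>\<bar>t\<bar>\<close> is larger, gives the upper
  bound. A small \<open>\<epsilon>\<close> lets the uniform convexity of
  \<open>norm z powr p\<close> beat the stretched remainder in the first coordinate.\<close>

lemma exists_potential_le_2:
  assumes p: "1 < p" "p \<le> 2"
  shows "\<exists>U g \<Psi> w A B C D L. martingale_potential p U g \<Psi> w A B C D L"
proof -
  define \<Psi> where "\<Psi> r t = t\<^sup>2 * (r + \<bar>t\<bar>) powr (p - 2)" for r t :: real
  define w where "w r a = 2 * (r + a) powr (p - 2)" for r a :: real
  define M where "M = 2 powr p + (1::real)"
  \<comment> \<open>\<open>c\<close> is the uniform convexity constant of
    \<open>norm z powr p\<close> and \<open>K\<close> the upper constant of the stretched remainder.
    The choice of \<open>\<epsilon>\<close> makes the stretched remainder consume at most half of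
    \<open>c\<close> in the first coordinate.\<close>
  define c where "c = p * (p - 1) / 2"
  define K where "K = M * (2 powr (2 - p) * (2 powr p + p))"
  define \<epsilon> where "\<epsilon> = min 1 (c / (2 * K))"
  \<comment> \<open>The first summand is the cost of \<open>e\<close> after stretching; the second
    pays for passing from \<open>norm z + norm h\<close> to \<open>norm z + \<bar>d\<bar>\<close>
    when \<open>e\<close> is large.\<close>
  define A where "A = K * \<epsilon> powr (p - 2) + c / 2"
  \<comment> \<open>\<open>1 / c\<close> stems from integrating \<open>2 * a powr (p - 2)\<close>
    twice, and \<open>2 powr (2 - p)\<close> from a comparison within a factor two.\<close>
  define B where "B = 2 powr (2 - p) * (1 / c)"
  define C where "C = c / 2 * 2 powr (p - 2)"
  define D where "D = p * (2 powr p + 2)"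
  have M: "0 \<le> M" by (simp add: M_def)
  have K: "0 < K" using p by (auto simp: K_def M_def intro!: mult_pos_pos add_pos_pos)
  have c: "0 < c" "c \<le> 1"
  proof -
    have "p * (p - 1) \<le> 2 * 1" using p by (intro mult_mono) auto
    then show "c \<le> 1" "0 < c" using p by (simp_all add: c_def)
  qed
  have \<epsilon>: "0 < \<epsilon>" "\<epsilon> \<le> 1" using c K by (auto simp: \<epsilon>_def)
  have K\<epsilon>: "K * \<epsilon> powr p \<le> c / 2"
  proof -
    have "\<epsilon> powr p \<le> \<epsilon> powr 1" using \<epsilon> p by (intro powr_mono') auto
    also have "\<dots> \<le> c / (2 * K)" using \<epsilon> by (simp add: \<epsilon>_def)
    finally have "K * \<epsilon> powr p \<le> K * (c / (2 * K))" using K by (intro mult_left_mono) auto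
    then show ?thesis using K by simp
  qed
  have A: "0 \<le> A" using K c by (simp add: A_def)
  have B: "0 \<le> B" using c by (simp add: B_def)
  have C: "0 < C" using c by (simp add: C_def)
  have "1 * (2 powr p + 2) \<le> D" unfolding D_def using p by (intro mult_right_mono) auto
  then have D1: "2 powr p + 2 \<le> D" by simp
  moreover have "0 \<le> 2 powr p" by simp
  ultimately have D2: "2 powr p \<le> D" and D3: "1 \<le> D" by linarith+
  obtain L where L: "1 \<le> L" "A * B \<le> C * L" using exists_scale[of C "A * B"] A B C by auto
  have cmp: "x powr (p - 2) \<le> y powr (p - 2)" if "0 < y" "y \<le> x" for x y
    using that p by (intro powr_mono2') auto
  have half: "x powr (p - 2) \<le> 2 powr (2 - p) * y powr (p - 2)" if "0 < x" "0 < y" "y \<le> 2 * x" for x y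
  proof -
    have "2 powr (2 - p) * ((2 * x) powr (p - 2)) \<le> 2 powr (2 - p) * y powr (p - 2)"
      using that cmp[of y "2 * x"] by (intro mult_left_mono) auto
    moreover have "2 powr (2 - p) * ((2 * x) powr (p - 2)) = x powr (p - 2)"
      using that by (simp add: powr_mult powr_add[symmetric] mult.assoc[symmetric])
    ultimately show ?thesis by simp
  qed
  have \<Psi>0: "0 \<le> \<Psi> r t" for r t by (simp add: \<Psi>_def)
  have \<Psi>_le: "\<Psi> r t \<le> (r + \<bar>t\<bar>) powr p" if r: "0 \<le> r" for r t
  proof -
    have "t\<^sup>2 * (r + \<bar>t\<bar>) powr (p - 2) \<le> (r + \<bar>t\<bar>)\<^sup>2 * (r + \<bar>t\<bar>) powr (p - 2)"
      using r by (intro mult_right_mono power2_le_iff_abs_le[THEN iffD2]) auto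
    then show ?thesis using r powr_square_split[of "r + \<bar>t\<bar>" p] by (simp add: \<Psi>_def mult.commute)
  qed
  have lower: "ennreal (\<Psi> r t) \<le> layer_integral w r t" if r: "0 \<le> r" for r t
  proof -
    have "ennreal (\<Psi> r t) = layer_integral (\<lambda>_ a. 2 * (r + \<bar>t\<bar>) powr (p - 2)) r t"
      by (subst layer_integral_const) (auto simp: \<Psi>_def mult_ac)
    also have "\<dots> \<le> layer_integral w r t"
      unfolding w_def using r by (intro layer_integral_mono mult_left_mono cmp) auto
    finally show ?thesis .
  qed
  have upper: "layer_integral w r t \<le> ennreal (B * \<Psi> r t)" if r: "0 \<le> r" for r t
  proof -
    have c1: "1 \<le> 1 / c" using c by simp
    consider "t = 0" | "t \<noteq> 0" "\<bar>t\<bar> \<le> r" | "r < \<bar>t\<bar>" by fastforce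
    then show ?thesis
    proof cases
      case 1
      then have "layer_integral w r t \<le> layer_integral (\<lambda>_ a. 0) r t" by (intro layer_integral_mono) auto
      then show ?thesis using 1 by (simp add: layer_integral_const)
    next
      case 2
      have "layer_integral w r t \<le> layer_integral (\<lambda>_ a. 2 * r powr (p - 2)) r t"
        unfolding w_def using 2 by (intro layer_integral_mono mult_left_mono cmp) auto
      also have "\<dots> = ennreal (r powr (p - 2) * t\<^sup>2)" by (subst layer_integral_const) auto
      also have "\<dots> \<le> ennreal (B * \<Psi> r t)"
      proof (intro ennreal_leI)
        have "r powr (p - 2) \<le> 2 powr (2 - p) * (r + \<bar>t\<bar>) powr (p - 2)" using 2 by (intro half) auto
        also have "\<dots> \<le> B * (r + \<bar>t\<bar>) powr (p - 2)"
          unfolding B_def using mult_left_mono[OF c1, of "2 powr (2 - p)"] by (intro mult_right_mono) auto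
        finally show "r powr (p - 2) * t\<^sup>2 \<le> B * \<Psi> r t"
          unfolding \<Psi>_def by (simp add: mult.left_commute[of B] mult.commute mult_left_mono)
      qed
      finally show ?thesis .
    next
      case 3
      have "layer_integral w r t \<le> layer_integral (\<lambda>_ a. 2 * a powr (p - 2)) r t"
        unfolding w_def using r by (intro layer_integral_mono mult_left_mono cmp) auto
      also have "\<dots> = ennreal (1 / c * (\<bar>t\<bar> powr (p - 2) * t\<^sup>2))"
        using powr_square_split[of "\<bar>t\<bar>" p] p by (subst layer_integral_powr) (auto simp: c_def)
      also have "\<dots> \<le> ennreal (B * \<Psi> r t)"
      proof (intro ennreal_leI)
        have "\<bar>t\<bar> powr (p - 2) \<le> 2 powr (2 - p) * (r + \<bar>t\<bar>) powr (p - 2)" using 3 r by (intro half) auto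
        then have "1 / c * (\<bar>t\<bar> powr (p - 2) * t\<^sup>2) \<le> 1 / c * ((2 powr (2 - p) * (r + \<bar>t\<bar>) powr (p - 2)) * t\<^sup>2)"
          using c by (intro mult_left_mono mult_right_mono) auto
        then show "1 / c * (\<bar>t\<bar> powr (p - 2) * t\<^sup>2) \<le> B * \<Psi> r t"
          by (simp add: B_def \<Psi>_def mult_ac)
      qed
      finally show ?thesis .
    qed
  qed
  have scale: "A * B * \<Psi> r t \<le> C * \<Psi> r (L * t)" if r: "0 \<le> r" for r t
  proof (cases "t = 0")
    case False
    \<comment> \<open>\<open>\<Psi>\<close> is jointly homogeneous of degree \<open>p\<close>, and
      since \<open>p - 2 \<le> 0\<close>, shrinking the first argument from \<open>L * r\<close>
      back to \<open>r\<close> does not decrease it.\<close>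
    have "L * \<Psi> r t \<le> L powr p * \<Psi> r t"
      using powr_ge_self[of L p] L p \<Psi>0 by (intro mult_right_mono) auto
    also have "\<dots> = L\<^sup>2 * t\<^sup>2 * (L * (r + \<bar>t\<bar>)) powr (p - 2)"
      using L r powr_square_split[of L p] by (simp add: \<Psi>_def powr_mult)
    also have "\<dots> \<le> L\<^sup>2 * t\<^sup>2 * (r + \<bar>L * t\<bar>) powr (p - 2)"
      using L r False by (intro mult_left_mono cmp)
        (auto simp: abs_mult distrib_left intro!: add_nonneg_pos mult_pos_pos mult_right_mono[of 1 L r, simplified])
    also have "\<dots> = \<Psi> r (L * t)" by (simp add: \<Psi>_def power_mult_distrib)
    finally have "C * (L * \<Psi> r t) \<le> C * \<Psi> r (L * t)" using C by (intro mult_left_mono) auto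
    moreover have "A * B * \<Psi> r t \<le> C * L * \<Psi> r t" using L \<Psi>0 by (intro mult_right_mono) auto
    ultimately show ?thesis by (simp add: mult_ac)
  qed (simp add: \<Psi>_def)
  have step: "power_potential p \<epsilon> (z + h) \<le> power_potential p \<epsilon> z + power_potential_grad p \<epsilon> z \<bullet> h +
        A * \<Psi> (norm z) (snd h) - C * \<Psi> (norm z) (fst h)" for z h :: "real \<times> real"
  proof -
    obtain d e where h: "h = (d, e)" by (cases h)
    let ?r = "norm z"
    let ?\<rho> = "?r + norm h"
    let ?q = "?\<rho> powr (p - 2)"
    let ?S = "stretch \<epsilon>"
    have hn: "(norm h)\<^sup>2 = d\<^sup>2 + e\<^sup>2" "(norm (?S h))\<^sup>2 = \<epsilon>\<^sup>2 * d\<^sup>2 + e\<^sup>2"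
      by (simp_all add: h stretch_def norm_prod_def power_mult_distrib)
    have up: "M * powr_norm_remainder p (?S z) (?S h) \<le> c / 2 * (?q * d\<^sup>2) + K * \<epsilon> powr (p - 2) * (?q * e\<^sup>2)"
    proof (cases "?\<rho> = 0")
      case True
      then have "z = 0" "h = 0" by (auto simp: add_nonneg_eq_0_iff)
      then show ?thesis by (simp add: stretch_def zero_prod_def powr_norm_remainder_def)
    next
      case False
      then have \<rho>: "0 < ?\<rho>" by (metis add_nonneg_nonneg norm_ge_zero order_le_less)
      \<comment> \<open>Stretching shrinks norms by at most the factor \<open>\<epsilon>\<close>,
        which the nonpositive exponent turns into the cost
        \<open>\<epsilon> powr (p - 2)\<close>.\<close>
      have "\<epsilon> * ?\<rho> \<le> norm (?S z) + norm (?S h)"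
        using norm_stretch_ge[of \<epsilon> z] norm_stretch_ge[of \<epsilon> h] \<epsilon> by (simp add: distrib_left)
      then have "(norm (?S z) + norm (?S h)) powr (p - 2) \<le> (\<epsilon> * ?\<rho>) powr (p - 2)"
        using \<epsilon> \<rho> by (intro cmp) auto
      also have "\<dots> = \<epsilon> powr (p - 2) * ?q" using \<epsilon> \<rho> by (simp add: powr_mult)
      finally have "K * ((norm (?S z) + norm (?S h)) powr (p - 2) * (norm (?S h))\<^sup>2)
          \<le> K * (\<epsilon> powr (p - 2) * ?q * (norm (?S h))\<^sup>2)"
        using K by (intro mult_left_mono mult_right_mono) auto
      moreover have "M * powr_norm_remainder p (?S z) (?S h)
          \<le> K * ((norm (?S z) + norm (?S h)) powr (p - 2) * (norm (?S h))\<^sup>2)"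
        unfolding K_def mult.assoc
        using powr_norm_remainder_upper_le_2[OF p, of "?S z" "?S h"] M by (intro mult_left_mono) (auto simp: mult.assoc)
      ultimately have "M * powr_norm_remainder p (?S z) (?S h) \<le> K * (\<epsilon> powr (p - 2) * ?q * (norm (?S h))\<^sup>2)"
        by simp
      \<comment> \<open>In the first coordinate the stretch contributes
        \<open>\<epsilon>\<^sup>2\<close>, reducing the cost to the small
        \<open>\<epsilon> powr p\<close>; the second coordinate bears the full cost, which enters
        \<open>A\<close>.\<close>
      also have "\<dots> = K * (\<epsilon> powr (p - 2) * \<epsilon>\<^sup>2) * (?q * d\<^sup>2) + K * \<epsilon> powr (p - 2) * (?q * e\<^sup>2)"
        unfolding hn by (simp add: algebra_simps)
      also have "\<epsilon> powr (p - 2) * \<epsilon>\<^sup>2 = \<epsilon> powr p" using powr_square_split[of \<epsilon> p] \<epsilon> by simp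
      also have "K * \<epsilon> powr p * (?q * d\<^sup>2) \<le> c / 2 * (?q * d\<^sup>2)" using K\<epsilon> by (intro mult_right_mono) auto
      finally show ?thesis by simp
    qed
    have "c * (?q * d\<^sup>2) \<le> c * (?q * (norm h)\<^sup>2)" using c by (intro mult_left_mono) (auto simp: hn)
    also have "\<dots> \<le> powr_norm_remainder p z h"
      using powr_norm_remainder_lower_le_2[OF p, of z h] by (simp add: c_def mult.assoc)
    finally have lo: "c * (?q * d\<^sup>2) \<le> powr_norm_remainder p z h" .
    have e: "?q * e\<^sup>2 \<le> \<Psi> ?r e"
    proof (cases "e = 0")
      case False
      then have "?q \<le> (?r + \<bar>e\<bar>) powr (p - 2)"
        using abs_le_norm_pair[of h] by (intro cmp) (auto simp: h intro: add_nonneg_pos)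
      then have "?q * e\<^sup>2 \<le> (?r + \<bar>e\<bar>) powr (p - 2) * e\<^sup>2" by (intro mult_right_mono) auto
      then show ?thesis by (simp add: \<Psi>_def mult.commute)
    qed (simp add: \<Psi>_def)
    \<comment> \<open>\<open>?q\<close> depends on \<open>e\<close> through \<open>norm h\<close>
      and may be far below the power in \<open>\<Psi> ?r d\<close>. This requires
      \<open>\<bar>e\<bar>\<close> to exceed \<open>?r + \<bar>d\<bar>\<close>, and then
      \<open>\<Psi> ?r e\<close> takes over.\<close>
    have d: "2 powr (p - 2) * \<Psi> ?r d \<le> ?q * d\<^sup>2 + \<Psi> ?r e"
    proof (cases "\<bar>e\<bar> \<le> ?r + \<bar>d\<bar>")
      case True
      show ?thesis
      proof (cases "d = 0")
        case False
        have "norm h \<le> \<bar>d\<bar> + \<bar>e\<bar>" using norm_Pair_le[of d e] by (simp add: h)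
        then have "(2 * (?r + \<bar>d\<bar>)) powr (p - 2) \<le> ?q"
          using True False by (intro cmp add_nonneg_pos) (auto simp: h zero_prod_def)
        moreover have "(2 * (?r + \<bar>d\<bar>)) powr (p - 2) = 2 powr (p - 2) * (?r + \<bar>d\<bar>) powr (p - 2)"
          by (subst powr_mult) auto
        ultimately have "2 powr (p - 2) * (?r + \<bar>d\<bar>) powr (p - 2) * d\<^sup>2 \<le> ?q * d\<^sup>2"
          by (intro mult_right_mono) simp_all
        then have "2 powr (p - 2) * \<Psi> ?r d \<le> ?q * d\<^sup>2" by (simp add: \<Psi>_def mult_ac)
        then show ?thesis using \<Psi>0[of ?r e] by linarith
      qed (use \<Psi>0[of ?r e] in \<open>simp add: \<Psi>_def\<close>)
    next
      case False
      then have e0: "0 < \<bar>e\<bar>" by (smt (verit) norm_ge_zero)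
      have "\<Psi> ?r d \<le> \<bar>e\<bar> powr p"
        by (rule order_trans[OF \<Psi>_le powr_mono2]) (use False p in auto)
      then have "2 powr (p - 2) * \<Psi> ?r d \<le> 2 powr (p - 2) * \<bar>e\<bar> powr p" by (intro mult_left_mono) auto
      also have "\<dots> = (2 * \<bar>e\<bar>) powr (p - 2) * e\<^sup>2"
        using powr_square_split[of "\<bar>e\<bar>" p] by (simp add: powr_mult)
      also have "\<dots> \<le> (?r + \<bar>e\<bar>) powr (p - 2) * e\<^sup>2"
        using False e0 by (intro mult_right_mono cmp) (auto intro: add_nonneg_pos)
      also have "\<dots> = \<Psi> ?r e" by (simp add: \<Psi>_def)
      finally show ?thesis by (simp add: add_increasing)
    qed
    have "c / 2 * (2 powr (p - 2) * \<Psi> ?r d) \<le> c / 2 * (?q * d\<^sup>2 + \<Psi> ?r e)"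
      using d c by (intro mult_left_mono) auto
    moreover have "K * \<epsilon> powr (p - 2) * (?q * e\<^sup>2) \<le> K * \<epsilon> powr (p - 2) * \<Psi> ?r e"
      using e K by (intro mult_left_mono) auto
    ultimately have "M * powr_norm_remainder p (?S z) (?S h) - powr_norm_remainder p z h
        \<le> A * \<Psi> ?r e - C * \<Psi> ?r d"
      using up lo by (simp add: A_def C_def algebra_simps)
    then show ?thesis unfolding power_potential_expand by (simp add: h M_def)
  qed
  have "martingale_potential p (power_potential p \<epsilon>) (power_potential_grad p \<epsilon>) \<Psi> w A B C D L"
  proof
    fix r t x y :: real and z h :: "real \<times> real"
    show "1 < p" "0 \<le> A" "0 \<le> B" "0 \<le> C" "0 < L" using p A B C L by auto
    show "power_potential p \<epsilon> \<in> borel_measurable borel" "power_potential_grad p \<epsilon> \<in> borel_measurable borel"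
      by simp_all
    show "case_prod \<Psi> \<in> borel_measurable (borel \<Otimes>\<^sub>M borel)" unfolding \<Psi>_def by measurable
    show "case_prod w \<in> borel_measurable (borel \<Otimes>\<^sub>M borel)" unfolding w_def by measurable
    show "power_potential p \<epsilon> 0 \<le> 0" by (simp add: power_potential_def stretch_def zero_prod_def)
    have "(2 powr p + 2) * norm z powr p \<le> D * norm z powr p" using D1 by (intro mult_right_mono) auto
    then show "\<bar>power_potential p \<epsilon> z\<bar> \<le> D * norm z powr p"
      using power_potential_bound[of p \<epsilon> z] p \<epsilon> by linarith
    show "norm (power_potential_grad p \<epsilon> z) \<le> D * norm z powr (p - 1)"
      using power_potential_grad_bound[of p \<epsilon> z] p \<epsilon> by (simp add: D_def)
    have "2 powr p * \<bar>x\<bar> powr p \<le> D * \<bar>x\<bar> powr p" using D2 by (intro mult_right_mono) auto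
    then show "\<bar>y\<bar> powr p \<le> power_potential p \<epsilon> (x, y) + D * \<bar>x\<bar> powr p"
      using power_potential_lower[of p \<epsilon> y x] p \<epsilon> by linarith
    have "1 * (r + \<bar>t\<bar>) powr p \<le> D * (r + \<bar>t\<bar>) powr p" using D3 by (intro mult_right_mono) auto
    then show "0 \<le> r \<Longrightarrow> \<Psi> r t \<le> D * (r + \<bar>t\<bar>) powr p" using \<Psi>_le[of r t] by linarith
    show "0 \<le> w r a" for a by (simp add: w_def)
  qed (use \<Psi>0 lower upper scale step in auto)
  then show ?thesis by blast
qed

lemma exists_potential:
  assumes "1 < p"
  shows "\<exists>U g \<Psi> w A B C D L. martingale_potential p U g \<Psi> w A B C D L"
  by (cases "p \<le> 2") (use assms exists_potential_le_2 exists_potential_ge_2 in auto)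

section \<open>Martingales with conditionally majorized differences\<close>

lemma powr_norm_remainder_nonneg:
  assumes "1 < p" shows "0 \<le> powr_norm_remainder p z h"
proof (cases "p \<le> 2")
  case True
  have "0 \<le> p * (p - 1) / 2 * (norm z + norm h) powr (p - 2) * (norm h)\<^sup>2" using assms by simp
  then show ?thesis using powr_norm_remainder_lower_le_2[OF assms True, of z h] by linarith
next
  case False
  have "0 \<le> p / 2 * norm z powr (p - 2) * (norm h)\<^sup>2" using assms by simp
  then show ?thesis using powr_norm_remainder_lower_ge_2[of p z h] False by linarith
qed

text \<open>Nonnegativity of the remainder gives a supporting line at the convex combination
  \<open>m\<close>, and averaging it over \<open>x\<close> and \<open>y\<close> cancels the linear
  terms. The result feeds the conditional Jensen inequality.\<close>

lemma convex_on_abs_powr: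
  assumes p: "1 < p" shows "convex_on UNIV (\<lambda>x::real. \<bar>x\<bar> powr p)"
proof (rule convex_onI)
  fix t x y :: real assume t: "0 < t" "t < 1"
  define m where "m = (1 - t) * x + t * y"
  have *: "\<bar>m\<bar> powr p + p * \<bar>m\<bar> powr (p - 2) * (m * (v - m)) \<le> \<bar>v\<bar> powr p" for v
    using powr_norm_remainder_nonneg[OF p, of m "v - m"] by (simp add: powr_norm_remainder_def)
  have "(1 - t) * (\<bar>m\<bar> powr p + p * \<bar>m\<bar> powr (p - 2) * (m * (x - m)))
      + t * (\<bar>m\<bar> powr p + p * \<bar>m\<bar> powr (p - 2) * (m * (y - m))) \<le> (1 - t) * \<bar>x\<bar> powr p + t * \<bar>y\<bar> powr p"
    using t by (intro add_mono mult_left_mono *) auto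
  moreover have "(1 - t) * (\<bar>m\<bar> powr p + p * \<bar>m\<bar> powr (p - 2) * (m * (x - m)))
      + t * (\<bar>m\<bar> powr p + p * \<bar>m\<bar> powr (p - 2) * (m * (y - m)))
      = \<bar>m\<bar> powr p + p * \<bar>m\<bar> powr (p - 2) * m * ((1 - t) * x + t * y - m)"
    by (simp add: algebra_simps)
  ultimately show "\<bar>(1 - t) *\<^sub>R x + t *\<^sub>R y\<bar> powr p \<le> (1 - t) * \<bar>x\<bar> powr p + t * \<bar>y\<bar> powr p"
    by (simp add: m_def)
qed auto

definition memLp :: "real \<Rightarrow> 'a measure \<Rightarrow> ('a \<Rightarrow> real) \<Rightarrow> bool" where
  "memLp p M X \<longleftrightarrow> X \<in> borel_measurable M \<and> integrable M (\<lambda>\<omega>. \<bar>X \<omega>\<bar> powr p)"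

lemma memLp_add:
  assumes p: "0 \<le> p" and X: "memLp p M X" and Y: "memLp p M Y"
  shows "memLp p M (\<lambda>\<omega>. X \<omega> + Y \<omega>)"
proof -
  have [measurable]: "X \<in> borel_measurable M" "Y \<in> borel_measurable M" using X Y by (auto simp: memLp_def)
  have "integrable M (\<lambda>\<omega>. \<bar>X \<omega> + Y \<omega>\<bar> powr p)"
  proof (rule Bochner_Integration.integrable_bound)
    show "integrable M (\<lambda>\<omega>. 2 powr p * (\<bar>X \<omega>\<bar> powr p + \<bar>Y \<omega>\<bar> powr p))"
      using X Y by (auto simp: memLp_def)
    have "\<bar>x + y\<bar> powr p \<le> 2 powr p * (\<bar>x\<bar> powr p + \<bar>y\<bar> powr p)" for x y :: real
      by (rule order_trans[OF powr_mono2 powr_sum_le]) (use p in auto)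
    then show "AE \<omega> in M. norm (\<bar>X \<omega> + Y \<omega>\<bar> powr p) \<le> norm (2 powr p * (\<bar>X \<omega>\<bar> powr p + \<bar>Y \<omega>\<bar> powr p))"
      by simp
  qed measurable
  then show ?thesis by (simp add: memLp_def)
qed

lemma memLp_cmult: "memLp p M X \<Longrightarrow> memLp p M (\<lambda>\<omega>. c * X \<omega>)"
  by (auto simp: memLp_def abs_mult powr_mult)

lemma memLp_abs: "memLp p M X \<Longrightarrow> memLp p M (\<lambda>\<omega>. \<bar>X \<omega>\<bar>)"
  by (auto simp: memLp_def)

lemma memLp_sum:
  assumes "0 < p" "\<And>i. i \<in> I \<Longrightarrow> memLp p M (X i)"
  shows "memLp p M (\<lambda>\<omega>. \<Sum>i\<in>I. X i \<omega>)"
  using assms(2)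
proof (induction I rule: infinite_finite_induct)
  case (insert i I)
  then show ?case using assms(1) by (simp add: memLp_add)
qed (use assms(1) in \<open>auto simp: memLp_def\<close>)

lemma integrable_memLp_bound:
  assumes S: "memLp p M S" and f: "f \<in> borel_measurable M"
    and le: "\<And>\<omega>. \<omega> \<in> space M \<Longrightarrow> \<bar>f \<omega>\<bar> \<le> D * \<bar>S \<omega>\<bar> powr p"
  shows "integrable M f"
proof (rule Bochner_Integration.integrable_bound[OF _ f])
  show "integrable M (\<lambda>\<omega>. D * \<bar>S \<omega>\<bar> powr p)" using S by (simp add: memLp_def)
  show "AE \<omega> in M. norm (f \<omega>) \<le> norm (D * \<bar>S \<omega>\<bar> powr p)"
    using le by (intro AE_I2) force
qed

section \<open>Conditional majorization, level by level\<close>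

text \<open>Conditional weak majorization: by the layer-cake formula, it controls all integrals of
  increasing convex functions whose weights depend only on the past.\<close>

definition cond_majorized :: "'a measure \<Rightarrow> 'a measure \<Rightarrow> ('a \<Rightarrow> real) \<Rightarrow> ('a \<Rightarrow> real) \<Rightarrow> bool" where
  "cond_majorized M F e d \<longleftrightarrow>
     (\<forall>H a. H \<in> borel_measurable F \<longrightarrow> (\<forall>\<omega>\<in>space M. 0 \<le> H \<omega>) \<longrightarrow> 0 < a \<longrightarrow>
       (\<integral>\<^sup>+\<omega>. ennreal (H \<omega> * max 0 (\<bar>e \<omega>\<bar> - a)) \<partial>M) \<le> (\<integral>\<^sup>+\<omega>. ennreal (H \<omega> * max 0 (\<bar>d \<omega>\<bar> - a)) \<partial>M))"

text \<open>Tonelli exchanges levels and sample points, leaving at each level a weighted mean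
  excess, the quantity that \<open>cond_majorized\<close> compares.\<close>

lemma layer_integral_swap:
  fixes w :: "real \<Rightarrow> real \<Rightarrow> real"
  assumes "sigma_finite_measure M"
    and w: "case_prod w \<in> borel_measurable (borel \<Otimes>\<^sub>M borel)"
    and [measurable]: "R \<in> borel_measurable M" "f \<in> borel_measurable M"
  shows "(\<integral>\<^sup>+\<omega>. layer_integral w (R \<omega>) (f \<omega>) \<partial>M) =
    (\<integral>\<^sup>+a. (\<integral>\<^sup>+\<omega>. ennreal (w (R \<omega>) a * max 0 (\<bar>f \<omega>\<bar> - a)) \<partial>M) * indicator {0<..} a \<partial>lborel)"
proof -
  interpret sigma_finite_measure M by fact
  interpret P: pair_sigma_finite M lborel ..
  have [measurable]: "(\<lambda>x. w (R (fst x)) (snd x)) \<in> borel_measurable (M \<Otimes>\<^sub>M lborel)"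
    using measurable_compose[OF _ w, of "\<lambda>x. (R (fst x), snd x)" "M \<Otimes>\<^sub>M lborel"] by simp
  have [measurable]: "(\<lambda>\<omega>. w (R \<omega>) a) \<in> borel_measurable M" for a
    using measurable_compose[OF _ w, of "\<lambda>x. (R x, a)" M] by simp
  have "(\<integral>\<^sup>+\<omega>. layer_integral w (R \<omega>) (f \<omega>) \<partial>M)
    = (\<integral>\<^sup>+a. (\<integral>\<^sup>+\<omega>. ennreal (w (R \<omega>) a * max 0 (\<bar>f \<omega>\<bar> - a)) * indicator {0<..} a \<partial>M) \<partial>lborel)"
    unfolding layer_integral_def by (rule P.Fubini'[symmetric]) (simp add: case_prod_beta')
  also have "\<dots> = (\<integral>\<^sup>+a. (\<integral>\<^sup>+\<omega>. ennreal (w (R \<omega>) a * max 0 (\<bar>f \<omega>\<bar> - a)) \<partial>M) * indicator {0<..} a \<partial>lborel)"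
    by (intro nn_integral_cong nn_integral_multc) measurable
  finally show ?thesis .
qed

text \<open>At each level \<open>a > 0\<close> the function
  \<open>\<lambda>\<omega>. w (R \<omega>) a\<close> is nonnegative and \<open>F\<close>-measurable,
  hence admissible as the weight \<open>H\<close>; the inequalities are then integrated over
  \<open>a\<close>.\<close>

lemma cond_majorized_layer:
  fixes w :: "real \<Rightarrow> real \<Rightarrow> real"
  assumes maj: "cond_majorized M F e d" and M: "sigma_finite_measure M" and F: "subalgebra M F"
    and w: "case_prod w \<in> borel_measurable (borel \<Otimes>\<^sub>M borel)" "\<And>r a. 0 \<le> r \<Longrightarrow> 0 < a \<Longrightarrow> 0 \<le> w r a"
    and R: "R \<in> borel_measurable F" "\<And>\<omega>. \<omega> \<in> space M \<Longrightarrow> 0 \<le> R \<omega>"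
    and de: "d \<in> borel_measurable M" "e \<in> borel_measurable M"
  shows "(\<integral>\<^sup>+\<omega>. layer_integral w (R \<omega>) (e \<omega>) \<partial>M) \<le> (\<integral>\<^sup>+\<omega>. layer_integral w (R \<omega>) (d \<omega>) \<partial>M)"
proof -
  have RM: "R \<in> borel_measurable M" using measurable_from_subalg[OF F R(1)] .
  have H: "(\<lambda>\<omega>. w (R \<omega>) a) \<in> borel_measurable F" for a
    using measurable_compose[OF _ w(1), of "\<lambda>x. (R x, a)" F] R(1) by simp
  show ?thesis
    unfolding layer_integral_swap[OF M w(1) RM de(1)] layer_integral_swap[OF M w(1) RM de(2)]
  proof (rule nn_integral_mono)
    fix a :: real
    have "(\<integral>\<^sup>+\<omega>. ennreal (w (R \<omega>) a * max 0 (\<bar>e \<omega>\<bar> - a)) \<partial>M)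
        \<le> (\<integral>\<^sup>+\<omega>. ennreal (w (R \<omega>) a * max 0 (\<bar>d \<omega>\<bar> - a)) \<partial>M)" if "0 < a"
      using maj H[of a] R(2) w(2) that unfolding cond_majorized_def by blast
    then show "(\<integral>\<^sup>+\<omega>. ennreal (w (R \<omega>) a * max 0 (\<bar>e \<omega>\<bar> - a)) \<partial>M) * indicator {0<..} a
        \<le> (\<integral>\<^sup>+\<omega>. ennreal (w (R \<omega>) a * max 0 (\<bar>d \<omega>\<bar> - a)) \<partial>M) * indicator {0<..} a"
      by (auto simp: indicator_def)
  qed
qed

lemma integral_mult_martingale_diff:
  assumes "prob_space M" "subalgebra M F"
    and "AE \<omega> in M. real_cond_exp M F d \<omega> = 0"
    and "f \<in> borel_measurable F" "d \<in> borel_measurable M" "integrable M (\<lambda>\<omega>. f \<omega> * d \<omega>)"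
  shows "(\<integral>\<omega>. f \<omega> * d \<omega> \<partial>M) = 0"
proof -
  interpret prob_space M by fact
  interpret finite_measure_subalgebra M F by standard fact
  have "(\<integral>\<omega>. f \<omega> * d \<omega> \<partial>M) = (\<integral>\<omega>. f \<omega> * real_cond_exp M F d \<omega> \<partial>M)"
    by (rule real_cond_exp_intg(2)[symmetric]) fact+
  also have "\<dots> = (\<integral>\<omega>. 0 \<partial>M)"
  proof (rule integral_cong_AE)
    show "(\<lambda>\<omega>. f \<omega> * real_cond_exp M F d \<omega>) \<in> borel_measurable M"
      using measurable_from_subalg[OF assms(2,4)] borel_measurable_cond_exp2[of M F d] by simp
    show "AE \<omega> in M. f \<omega> * real_cond_exp M F d \<omega> = 0" using assms(3) by auto
  qed simp
  finally show ?thesis by simp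
qed

section \<open>Integrability of partial sums and differences\<close>

locale martingale_filtration = prob_space M for M :: "'a measure" +
  fixes F :: "nat \<Rightarrow> 'a measure"
  assumes sub: "\<And>k. subalgebra M (F k)"
    and mono: "\<And>j k. j \<le> k \<Longrightarrow> subalgebra (F k) (F j)"
begin

lemma martingale_diff_seq_partial_sum_measurable:
  assumes "martingale_diff_seq M F d"
  shows "(\<lambda>\<omega>. \<Sum>j=1..k. d j \<omega>) \<in> borel_measurable (F k)"
  using assms by (intro borel_measurable_sum)
    (auto simp: martingale_diff_seq_def intro: measurable_from_subalg[OF mono])

text \<open>The sum up to \<open>k\<close> is the conditional expectation of the sum up to
  \<open>Suc k\<close>, so conditional Jensen passes p-integrability down one index.\<close>

lemma partial_sum_memLp_pred:
  assumes d: "martingale_diff_seq M F d" and p: "1 < p"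
    and X: "memLp p M (\<lambda>\<omega>. \<Sum>j=1..Suc k. d j \<omega>)"
  shows "memLp p M (\<lambda>\<omega>. \<Sum>j=1..k. d j \<omega>)"
proof -
  interpret finite_measure_subalgebra M "F k" by standard (rule sub)
  let ?X = "\<lambda>k \<omega>. \<Sum>j=1..k. d j \<omega>"
  have int: "integrable M (?X k)" for k using d by (auto simp: martingale_diff_seq_def)
  have dk: "integrable M (d (Suc k))" "AE \<omega> in M. real_cond_exp M (F k) (d (Suc k)) \<omega> = 0"
    using d by (auto simp: martingale_diff_seq_def dest: spec[of _ "Suc k"])
  have "AE \<omega> in M. real_cond_exp M (F k) (\<lambda>\<omega>. ?X k \<omega> + d (Suc k) \<omega>) \<omega>
      = real_cond_exp M (F k) (?X k) \<omega> + real_cond_exp M (F k) (d (Suc k)) \<omega>"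
    by (rule real_cond_exp_add[OF int dk(1)])
  moreover have "AE \<omega> in M. real_cond_exp M (F k) (?X k) \<omega> = ?X k \<omega>"
    by (rule real_cond_exp_F_meas[OF int martingale_diff_seq_partial_sum_measurable[OF d]])
  ultimately have AE: "AE \<omega> in M. real_cond_exp M (F k) (?X (Suc k)) \<omega> = ?X k \<omega>"
    using dk(2) by eventually_elim simp
  have "integrable M (\<lambda>\<omega>. \<bar>real_cond_exp M (F k) (?X (Suc k)) \<omega>\<bar> powr p)"
    by (rule integrable_convex_cond_exp[OF int _ _ _ convex_on_abs_powr[OF p]])
      (use X in \<open>auto simp: memLp_def\<close>)
  then have "integrable M (\<lambda>\<omega>. \<bar>?X k \<omega>\<bar> powr p)"
    using AE borel_measurable_integrable[OF int[of k]]
    by (subst integrable_cong_AE[where g = "\<lambda>\<omega>. \<bar>real_cond_exp M (F k) (?X (Suc k)) \<omega>\<bar> powr p"]) auto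
  then show ?thesis using int[of k] by (auto simp: memLp_def)
qed

lemma partial_sum_memLp_le:
  assumes d: "martingale_diff_seq M F d" and p: "1 < p"
    and X: "memLp p M (\<lambda>\<omega>. \<Sum>j=1..n. d j \<omega>)" and k: "k \<le> n"
  shows "memLp p M (\<lambda>\<omega>. \<Sum>j=1..k. d j \<omega>)"
  using k
proof (induction k rule: inc_induct)
  case (step k)
  then show ?case using partial_sum_memLp_pred[OF d p] by blast
qed (rule X)

lemma martingale_diff_memLp:
  assumes d: "martingale_diff_seq M F d" and p: "1 < p"
    and X: "memLp p M (\<lambda>\<omega>. \<Sum>j=1..n. d j \<omega>)" and k: "1 \<le> k" "k \<le> n"
  shows "memLp p M (d k)"
proof -
  obtain j where j: "k = Suc j" using k by (cases k) auto
  have "memLp p M (\<lambda>\<omega>. (\<Sum>i=1..k. d i \<omega>) + (-1) * (\<Sum>i=1..j. d i \<omega>))"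
    using k j p by (intro memLp_add memLp_cmult partial_sum_memLp_le[OF d p X]) auto
  then show ?thesis by (simp add: j)
qed

end

text \<open>The weight \<open>p * (p - 1) * a powr (p - 2)\<close> has layer integral exactly
  \<open>\<bar>t\<bar> powr p\<close>, so majorization compares p-th moments.\<close>

lemma cond_majorized_memLp:
  assumes maj: "cond_majorized M F e d" and M: "sigma_finite_measure M" and F: "subalgebra M F"
    and p: "1 < p" and d: "memLp p M d" and e: "e \<in> borel_measurable M"
  shows "memLp p M e"
proof -
  let ?w = "\<lambda>_ a. (p * (p - 1)) * a powr (p - 2)"
  have layer: "layer_integral ?w r t = ennreal (\<bar>t\<bar> powr p)" for r t
    using layer_integral_powr[of "p * (p - 1)" p] p by simp
  have "(\<integral>\<^sup>+\<omega>. layer_integral ?w 0 (e \<omega>) \<partial>M) \<le> (\<integral>\<^sup>+\<omega>. layer_integral ?w 0 (d \<omega>) \<partial>M)"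
    by (rule cond_majorized_layer[OF maj M F, where R = "\<lambda>_. 0"]) (use p d e in \<open>auto simp: memLp_def\<close>)
  also have "\<dots> < \<infinity>" using d by (auto simp: layer memLp_def integrable_iff_bounded)
  finally show ?thesis using e by (auto simp: layer memLp_def integrable_iff_bounded)
qed

section \<open>Decrease of the mean potential\<close>

context martingale_potential
begin

text \<open>Expand \<open>U\<close> at \<open>(L * X, Y)\<close> in the direction
  \<open>(L * d, e)\<close>. The gradient depends only on the past, so its pairing with the
  conditionally centred increments has mean zero; majorization makes the mean of the error
  nonpositive.\<close>

lemma potential_step:
  fixes M :: "'a measure" and F :: "'a measure"
  assumes "prob_space M" and F: "subalgebra M F"
    and X: "X \<in> borel_measurable F" "memLp p M X" and Y: "Y \<in> borel_measurable F" "memLp p M Y"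
    and d: "memLp p M d" "AE \<omega> in M. real_cond_exp M F d \<omega> = 0"
    and e: "memLp p M e" "AE \<omega> in M. real_cond_exp M F e \<omega> = 0"
    and maj: "cond_majorized M F e d"
  shows "integrable M (\<lambda>\<omega>. U (L * X \<omega>, Y \<omega>))"
    and "(\<integral>\<omega>. U (L * (X \<omega> + d \<omega>), Y \<omega> + e \<omega>) \<partial>M) \<le> (\<integral>\<omega>. U (L * X \<omega>, Y \<omega>) \<partial>M)"
proof -
  interpret prob_space M by fact
  define Z where "Z \<omega> = (L * X \<omega>, Y \<omega>)" for \<omega>
  define h where "h \<omega> = (L * d \<omega>, e \<omega>)" for \<omega>
  \<comment> \<open>\<open>S\<close> dominates every norm that occurs, so each integrability claim
    reduces to a bound by \<open>D * S powr p\<close>. The unscaled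
    \<open>\<bar>d \<omega>\<bar>\<close> is included because \<open>\<Psi>\<close> is integrated at
    \<open>d\<close> too and only \<open>0 < L\<close> is known.\<close>
  define S where "S \<omega> = \<bar>L * X \<omega>\<bar> + \<bar>Y \<omega>\<bar> + \<bar>L * d \<omega>\<bar> + \<bar>d \<omega>\<bar> + \<bar>e \<omega>\<bar>" for \<omega>
  have [measurable]: "X \<in> borel_measurable M" "Y \<in> borel_measurable M" "d \<in> borel_measurable M" "e \<in> borel_measurable M"
    using X Y d e by (auto simp: memLp_def)
  note [measurable] = X(1) Y(1)
  have ZF [measurable]: "Z \<in> borel_measurable F" unfolding Z_def borel_prod[symmetric] by measurable
  have ZM [measurable]: "Z \<in> borel_measurable M" using measurable_from_subalg[OF F ZF] .
  have hM [measurable]: "h \<in> borel_measurable M" unfolding h_def borel_prod[symmetric] by measurable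
  have S: "memLp p M S"
    unfolding S_def using p X Y d e by (intro memLp_add memLp_abs memLp_cmult) auto
  have S0: "0 \<le> S \<omega>" for \<omega> by (simp add: S_def)
  have ZS: "norm (Z \<omega>) \<le> S \<omega>" "norm (Z \<omega>) + \<bar>e \<omega>\<bar> \<le> S \<omega>" "norm (Z \<omega>) + \<bar>d \<omega>\<bar> \<le> S \<omega>"
      "norm (Z \<omega>) + \<bar>L * d \<omega>\<bar> \<le> S \<omega>" "norm (Z \<omega> + h \<omega>) \<le> S \<omega>" "\<bar>L * d \<omega>\<bar> \<le> S \<omega>" "\<bar>e \<omega>\<bar> \<le> S \<omega>" for \<omega>
  proof -
    have "norm (Z \<omega>) \<le> \<bar>L * X \<omega>\<bar> + \<bar>Y \<omega>\<bar>" using norm_Pair_le[of "L * X \<omega>" "Y \<omega>"] by (simp add: Z_def)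
    moreover have "norm (h \<omega>) \<le> \<bar>L * d \<omega>\<bar> + \<bar>e \<omega>\<bar>" using norm_Pair_le[of "L * d \<omega>" "e \<omega>"] by (simp add: h_def)
    moreover note norm_triangle_ineq[of "Z \<omega>" "h \<omega>"]
    ultimately show "norm (Z \<omega>) \<le> S \<omega>" "norm (Z \<omega>) + \<bar>e \<omega>\<bar> \<le> S \<omega>" "norm (Z \<omega>) + \<bar>d \<omega>\<bar> \<le> S \<omega>"
      "norm (Z \<omega>) + \<bar>L * d \<omega>\<bar> \<le> S \<omega>" "norm (Z \<omega> + h \<omega>) \<le> S \<omega>" "\<bar>L * d \<omega>\<bar> \<le> S \<omega>" "\<bar>e \<omega>\<bar> \<le> S \<omega>"
      unfolding S_def by linarith+
  qed
  have D: "0 \<le> D"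
    using U_bound[of "(1, 0)"] by (simp add: order_trans[OF abs_ge_zero])
  have mono: "D * x powr p \<le> D * S \<omega> powr p" if "0 \<le> x" "x \<le> S \<omega>" for x \<omega>
    using that D p by (intro mult_left_mono powr_mono2) auto
  have intU: "integrable M (\<lambda>\<omega>. U (Z \<omega>))" "integrable M (\<lambda>\<omega>. U (Z \<omega> + h \<omega>))"
    using order_trans[OF U_bound mono[OF norm_ge_zero ZS(1)]] order_trans[OF U_bound mono[OF norm_ge_zero ZS(5)]] S0
    by (auto intro!: integrable_memLp_bound[OF S])
  have \<Psi>M: "(\<lambda>\<omega>. \<Psi> (norm (Z \<omega>)) (f \<omega>)) \<in> borel_measurable M" if "f \<in> borel_measurable M" for f
    using measurable_compose[OF _ \<Psi>_measurable, of "\<lambda>\<omega>. (norm (Z \<omega>), f \<omega>)" M] that by simp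
  have int\<Psi>: "integrable M (\<lambda>\<omega>. \<Psi> (norm (Z \<omega>)) (f \<omega>))"
    if "f \<in> borel_measurable M" "\<And>\<omega>. norm (Z \<omega>) + \<bar>f \<omega>\<bar> \<le> S \<omega>" for f
  proof (rule integrable_memLp_bound[OF S \<Psi>M[OF that(1)]])
    fix \<omega>
    have "\<Psi> (norm (Z \<omega>)) (f \<omega>) \<le> D * S \<omega> powr p"
      by (rule order_trans[OF \<Psi>_bound mono[OF _ that(2)]]) auto
    then show "\<bar>\<Psi> (norm (Z \<omega>)) (f \<omega>)\<bar> \<le> D * \<bar>S \<omega>\<bar> powr p" using \<Psi>_nonneg S0[of \<omega>] by simp
  qed
  have int\<Psi>e: "integrable M (\<lambda>\<omega>. \<Psi> (norm (Z \<omega>)) (e \<omega>))"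
    and int\<Psi>d: "integrable M (\<lambda>\<omega>. \<Psi> (norm (Z \<omega>)) (d \<omega>))"
    and int\<Psi>Ld: "integrable M (\<lambda>\<omega>. \<Psi> (norm (Z \<omega>)) (L * d \<omega>))"
    using ZS by (auto intro!: int\<Psi>)
  \<comment> \<open>The degree \<open>p - 1\<close> of the gradient bound and the degree
    \<open>1\<close> of the increment add up to \<open>p\<close>. The function \<open>c\<close>
    stands for \<open>fst\<close> or \<open>snd\<close>.\<close>
  have intg: "integrable M (\<lambda>\<omega>. c (g (Z \<omega>)) * f \<omega>)"
    if [measurable]: "f \<in> borel_measurable M" "c \<in> borel_measurable borel"
      and c: "\<And>z. \<bar>c z\<bar> \<le> norm z" and f: "\<And>\<omega>. \<bar>f \<omega>\<bar> \<le> S \<omega>" for f and c :: "real \<times> real \<Rightarrow> real"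
  proof (rule integrable_memLp_bound[OF S])
    fix \<omega>
    have "\<bar>c (g (Z \<omega>)) * f \<omega>\<bar> \<le> (D * norm (Z \<omega>) powr (p - 1)) * S \<omega>"
      unfolding abs_mult by (intro mult_mono order_trans[OF c g_bound] f) (auto simp: D)
    also have "\<dots> \<le> (D * S \<omega> powr (p - 1)) * S \<omega>"
      using D p ZS(1) S0 by (intro mult_right_mono mult_left_mono powr_mono2) auto
    also have "\<dots> = D * S \<omega> powr p"
      using powr_add[of "S \<omega>" "p - 1" 1] S0[of \<omega>] by (cases "S \<omega> = 0") auto
    finally show "\<bar>c (g (Z \<omega>)) * f \<omega>\<bar> \<le> D * \<bar>S \<omega>\<bar> powr p" using S0[of \<omega>] by simp
  qed measurable
  have int1: "integrable M (\<lambda>\<omega>. fst (g (Z \<omega>)) * (L * d \<omega>))" and int2: "integrable M (\<lambda>\<omega>. snd (g (Z \<omega>)) * e \<omega>)"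
    by (intro intg; simp add: abs_le_norm_pair ZS borel_prod[symmetric])+
  have gF: "(\<lambda>\<omega>. fst (g (Z \<omega>))) \<in> borel_measurable F" "(\<lambda>\<omega>. snd (g (Z \<omega>))) \<in> borel_measurable F"
    using measurable_compose[OF ZF g_measurable]
    by (auto simp: borel_prod[symmetric] intro: measurable_compose[OF _ measurable_fst] measurable_compose[OF _ measurable_snd])
  have zero1: "(\<integral>\<omega>. fst (g (Z \<omega>)) * (L * d \<omega>) \<partial>M) = 0"
  proof -
    have "integrable M (\<lambda>\<omega>. fst (g (Z \<omega>)) * d \<omega>)"
      using integrable_mult_right[OF int1, of "1 / L"] params by (simp add: mult.left_commute)
    then have "(\<integral>\<omega>. fst (g (Z \<omega>)) * d \<omega> \<partial>M) = 0"
      using d(2) by (intro integral_mult_martingale_diff[OF prob_space_axioms F _ gF(1)]) auto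
    then show ?thesis by (simp add: mult.left_commute)
  qed
  have zero2: "(\<integral>\<omega>. snd (g (Z \<omega>)) * e \<omega> \<partial>M) = 0"
    using e(2) int2 by (intro integral_mult_martingale_diff[OF prob_space_axioms F _ gF(2)]) auto
  \<comment> \<open>The layer integral mediates: majorization compares it at \<open>e\<close> and
    \<open>d\<close>, and returning to \<open>\<Psi>\<close> costs \<open>B\<close>. Then
    \<open>\<Psi>_scale\<close> absorbs \<open>A * B\<close> into the scaling by
    \<open>L\<close>.\<close>
  have "(\<integral>\<^sup>+\<omega>. ennreal (\<Psi> (norm (Z \<omega>)) (e \<omega>)) \<partial>M) \<le> (\<integral>\<^sup>+\<omega>. layer_integral w (norm (Z \<omega>)) (e \<omega>) \<partial>M)"
    by (intro nn_integral_mono \<Psi>_le_layer) auto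
  also have "\<dots> \<le> (\<integral>\<^sup>+\<omega>. layer_integral w (norm (Z \<omega>)) (d \<omega>) \<partial>M)"
    by (rule cond_majorized_layer[OF maj _ F w_measurable w_nonneg]) (auto intro: sigma_finite_measure_axioms)
  also have "\<dots> \<le> (\<integral>\<^sup>+\<omega>. ennreal (B * \<Psi> (norm (Z \<omega>)) (d \<omega>)) \<partial>M)"
    by (intro nn_integral_mono layer_le_\<Psi>) auto
  finally have "(\<integral>\<omega>. \<Psi> (norm (Z \<omega>)) (e \<omega>) \<partial>M) \<le> (\<integral>\<omega>. B * \<Psi> (norm (Z \<omega>)) (d \<omega>) \<partial>M)"
    using int\<Psi>e int\<Psi>d params \<Psi>_nonneg by (simp add: nn_integral_eq_integral)
  then have "A * (\<integral>\<omega>. \<Psi> (norm (Z \<omega>)) (e \<omega>) \<partial>M) \<le> A * (\<integral>\<omega>. B * \<Psi> (norm (Z \<omega>)) (d \<omega>) \<partial>M)"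
    using params by (intro mult_left_mono) auto
  also have "\<dots> = (\<integral>\<omega>. A * B * \<Psi> (norm (Z \<omega>)) (d \<omega>) \<partial>M)" by (simp add: mult.assoc)
  also have "\<dots> \<le> (\<integral>\<omega>. C * \<Psi> (norm (Z \<omega>)) (L * d \<omega>) \<partial>M)"
    using int\<Psi>d int\<Psi>Ld \<Psi>_scale by (intro integral_mono) auto
  also have "\<dots> = C * (\<integral>\<omega>. \<Psi> (norm (Z \<omega>)) (L * d \<omega>) \<partial>M)" by simp
  finally have compare: "A * (\<integral>\<omega>. \<Psi> (norm (Z \<omega>)) (e \<omega>) \<partial>M) \<le> C * (\<integral>\<omega>. \<Psi> (norm (Z \<omega>)) (L * d \<omega>) \<partial>M)" .
  have "(\<integral>\<omega>. U (Z \<omega> + h \<omega>) \<partial>M) \<le> (\<integral>\<omega>. U (Z \<omega>) + fst (g (Z \<omega>)) * (L * d \<omega>) + snd (g (Z \<omega>)) * e \<omega>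
      + A * \<Psi> (norm (Z \<omega>)) (e \<omega>) - C * \<Psi> (norm (Z \<omega>)) (L * d \<omega>) \<partial>M)"
  proof (rule integral_mono)
    fix \<omega>
    show "U (Z \<omega> + h \<omega>) \<le> U (Z \<omega>) + fst (g (Z \<omega>)) * (L * d \<omega>) + snd (g (Z \<omega>)) * e \<omega>
      + A * \<Psi> (norm (Z \<omega>)) (e \<omega>) - C * \<Psi> (norm (Z \<omega>)) (L * d \<omega>)"
      using U_step[of "Z \<omega>" "h \<omega>"] by (simp add: h_def inner_prod_def)
  qed (use intU int1 int2 int\<Psi>e int\<Psi>Ld in auto)
  also have "\<dots> = (\<integral>\<omega>. U (Z \<omega>) \<partial>M) + A * (\<integral>\<omega>. \<Psi> (norm (Z \<omega>)) (e \<omega>) \<partial>M) - C * (\<integral>\<omega>. \<Psi> (norm (Z \<omega>)) (L * d \<omega>) \<partial>M)"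
    using intU int1 int2 int\<Psi>e int\<Psi>Ld zero1 zero2 by simp
  also have "\<dots> \<le> (\<integral>\<omega>. U (Z \<omega>) \<partial>M)" using compare by simp
  finally show "(\<integral>\<omega>. U (L * (X \<omega> + d \<omega>), Y \<omega> + e \<omega>) \<partial>M) \<le> (\<integral>\<omega>. U (L * X \<omega>, Y \<omega>) \<partial>M)"
    by (simp add: Z_def h_def distrib_left)
  show "integrable M (\<lambda>\<omega>. U (L * X \<omega>, Y \<omega>))" using intU(1) by (simp add: Z_def)
qed

text \<open>The potential starts at a nonpositive value and its mean never increases, so its mean at
  \<open>n\<close> is nonpositive. \<open>U_lower\<close> with first coordinate scaled by
  \<open>L\<close> then produces the constant \<open>D * L powr p\<close>.\<close>

lemma partial_sum_inequality:
  assumes "martingale_filtration M F"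
    and d: "martingale_diff_seq M F d" and e: "martingale_diff_seq M F e"
    and maj: "\<And>k. 1 \<le> k \<Longrightarrow> cond_majorized M (F (k - 1)) (e k) (d k)"
    and X: "memLp p M (\<lambda>\<omega>. \<Sum>j=1..n. d j \<omega>)"
  shows "memLp p M (\<lambda>\<omega>. \<Sum>j=1..n. e j \<omega>)"
    and "(\<integral>\<omega>. \<bar>\<Sum>j=1..n. e j \<omega>\<bar> powr p \<partial>M) \<le> D * L powr p * (\<integral>\<omega>. \<bar>\<Sum>j=1..n. d j \<omega>\<bar> powr p \<partial>M)"
proof -
  interpret martingale_filtration M F by fact
  let ?X = "\<lambda>k \<omega>. \<Sum>j=1..k. d j \<omega>" and ?Y = "\<lambda>k \<omega>. \<Sum>j=1..k. e j \<omega>"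
  have dL: "memLp p M (d k)" if "1 \<le> k" "k \<le> n" for k
    using martingale_diff_memLp[OF d p X that] .
  \<comment> \<open>Only the sum of the \<open>d j\<close> is assumed p-integrable; the differences
    \<open>e k\<close> inherit this through majorization.\<close>
  have eL: "memLp p M (e k)" if "1 \<le> k" "k \<le> n" for k
    using e that by (intro cond_majorized_memLp[OF maj sigma_finite_measure_axioms sub p dL])
      (auto simp: martingale_diff_seq_def)
  have XL: "memLp p M (?X k)" if "k \<le> n" for k using partial_sum_memLp_le[OF d p X that] .
  have YL: "memLp p M (?Y k)" if "k \<le> n" for k using that p by (intro memLp_sum eL) auto
  have ae: "AE \<omega> in M. real_cond_exp M (F k) (d (Suc k)) \<omega> = 0" "AE \<omega> in M. real_cond_exp M (F k) (e (Suc k)) \<omega> = 0" for k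
    using d e by (auto simp: martingale_diff_seq_def dest: spec[of _ "Suc k"])
  have maj': "cond_majorized M (F k) (e (Suc k)) (d (Suc k))" for k using maj[of "Suc k"] by simp
  have "(\<integral>\<omega>. U (L * ?X k \<omega>, ?Y k \<omega>) \<partial>M) \<le> 0" if "k \<le> n" for k
    using that
  proof (induction k)
    case 0
    then show ?case using U_0 prob_space by (simp add: zero_prod_def)
  next
    case (Suc k)
    have "(\<integral>\<omega>. U (L * (?X k \<omega> + d (Suc k) \<omega>), ?Y k \<omega> + e (Suc k) \<omega>) \<partial>M) \<le> (\<integral>\<omega>. U (L * ?X k \<omega>, ?Y k \<omega>) \<partial>M)"
      using Suc.prems
      by (intro potential_step(2)[OF prob_space_axioms sub[of k] martingale_diff_seq_partial_sum_measurable[OF d] XL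
          martingale_diff_seq_partial_sum_measurable[OF e] YL dL ae(1) eL ae(2) maj']) auto
    then show ?case using Suc by simp
  qed
  then have neg: "(\<integral>\<omega>. U (L * ?X n \<omega>, ?Y n \<omega>) \<partial>M) \<le> 0" by simp
  show YLn: "memLp p M (?Y n)" using YL by simp
  \<comment> \<open>Zero increments make \<open>potential_step\<close> yield integrability of the
    potential at the final index.\<close>
  have memLp0: "memLp p M (\<lambda>_. 0)" by (simp add: memLp_def)
  have "AE \<omega> in M. real_cond_exp M (F n) (\<lambda>_. 0) \<omega> = 0"
  proof -
    interpret finite_measure_subalgebra M "F n" by standard (rule sub)
    show ?thesis by (rule real_cond_exp_F_meas) auto
  qed
  then have intU: "integrable M (\<lambda>\<omega>. U (L * ?X n \<omega>, ?Y n \<omega>))"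
    by (intro potential_step(1)[OF prob_space_axioms sub[of n] martingale_diff_seq_partial_sum_measurable[OF d] XL
          martingale_diff_seq_partial_sum_measurable[OF e] YL memLp0 _ memLp0]) (auto simp: cond_majorized_def)
  have intX: "integrable M (\<lambda>\<omega>. \<bar>?X n \<omega>\<bar> powr p)" using X by (simp add: memLp_def)
  have "(\<integral>\<omega>. \<bar>?Y n \<omega>\<bar> powr p \<partial>M) \<le> (\<integral>\<omega>. U (L * ?X n \<omega>, ?Y n \<omega>) + D * L powr p * \<bar>?X n \<omega>\<bar> powr p \<partial>M)"
  proof (rule integral_mono)
    show "integrable M (\<lambda>\<omega>. \<bar>?Y n \<omega>\<bar> powr p)" using YLn by (simp add: memLp_def)
    show "\<bar>?Y n \<omega>\<bar> powr p \<le> U (L * ?X n \<omega>, ?Y n \<omega>) + D * L powr p * \<bar>?X n \<omega>\<bar> powr p" for \<omega>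
      using U_lower[of "?Y n \<omega>" "L * ?X n \<omega>"] params by (simp add: abs_mult powr_mult mult.assoc)
  qed (use intU intX in auto)
  also have "\<dots> = (\<integral>\<omega>. U (L * ?X n \<omega>, ?Y n \<omega>) \<partial>M) + D * L powr p * (\<integral>\<omega>. \<bar>?X n \<omega>\<bar> powr p \<partial>M)"
    using intU intX by simp
  finally show "(\<integral>\<omega>. \<bar>?Y n \<omega>\<bar> powr p \<partial>M) \<le> D * L powr p * (\<integral>\<omega>. \<bar>?X n \<omega>\<bar> powr p \<partial>M)"
    using neg by simp
qed

end

section \<open>Contractions on the unit interval and slices of the cube\<close>

lemma abs_L1_eq_iff:
  assumes "integrable leb01 f" "integrable leb01 g"
  shows "abs_L1 f = abs_L1 g \<longleftrightarrow> (AE t in leb01. f t = g t)"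
  using Quotient3_rel[OF Quotient3_L1, of f g] assms by (auto simp: L1rel_def)

lemma L1_representative:
  obtains f where "integrable leb01 f" "abs_L1 f = x"
  using Quotient3_rep_reflp[OF Quotient3_L1, of x] Quotient3_abs_rep[OF Quotient3_L1, of x]
  by (auto simp: L1rel_def)

lemma abs_L1_add:
  assumes "integrable leb01 f" "integrable leb01 g"
  shows "abs_L1 (\<lambda>t. f t + g t) = abs_L1 f + abs_L1 g"
  using assms by (simp add: plus_L1.abs_eq L1rel_def)

lemma norm_abs_L1:
  assumes "integrable leb01 f" shows "norm (abs_L1 f) = (\<integral>t. \<bar>f t\<bar> \<partial>leb01)"
  using assms by (simp add: norm_L1.abs_eq L1rel_def)

lemma Linf_norm_abs_L1:
  assumes "integrable leb01 f" shows "Linf_norm (abs_L1 f) = esssup leb01 (\<lambda>t. ennreal \<bar>f t\<bar>)"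
  using assms by (simp add: Linf_norm.abs_eq L1rel_def)

text \<open>Clip \<open>f\<close> at height \<open>a\<close>: the image of the clipped part stays below \<open>a\<close>, and the image of the
  remainder has \<open>L\<^sub>1\<close> norm at most \<open>\<integral> (\<bar>f\<bar> - a)\<^sup>+\<close>.\<close>

lemma L1_Linf_contraction_excess:
  assumes S: "L1_Linf_contraction S" and f: "integrable leb01 f" and g: "integrable leb01 g"
    and eq: "abs_L1 g = S (abs_L1 f)" and a: "0 < a"
  shows "(\<integral>\<^sup>+t. ennreal (max 0 (\<bar>g t\<bar> - a)) \<partial>leb01) \<le> (\<integral>\<^sup>+t. ennreal (max 0 (\<bar>f t\<bar> - a)) \<partial>leb01)"
proof -
  interpret prob_space leb01 by (rule prob_space_leb01)
  have [measurable]: "f \<in> borel_measurable leb01" using f by auto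
  define f1 where "f1 t = max (- a) (min a (f t))" for t
  define f2 where "f2 t = f t - f1 t" for t
  have "f1 \<in> borel_measurable leb01" unfolding f1_def by measurable
  then have f1: "integrable leb01 f1"
    by (intro integrable_const_bound[of _ a]) (use a in \<open>auto simp: f1_def\<close>)
  have f2: "integrable leb01 f2" unfolding f2_def using f f1 by auto
  obtain g1 where g1: "integrable leb01 g1" "abs_L1 g1 = S (abs_L1 f1)" by (rule L1_representative)
  obtain g2 where g2: "integrable leb01 g2" "abs_L1 g2 = S (abs_L1 f2)" by (rule L1_representative)
  have lin: "bounded_linear S" and norm: "onorm S \<le> 1"
    and Linf: "\<And>u. Linf_norm u < \<infinity> \<Longrightarrow> Linf_norm (S u) \<le> Linf_norm u"
    using S by (auto simp: L1_Linf_contraction_def)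
  have "abs_L1 f = abs_L1 f1 + abs_L1 f2"
    using abs_L1_add[OF f1 f2] by (simp add: f2_def)
  then have "abs_L1 g = abs_L1 g1 + abs_L1 g2"
    using eq g1 g2 linear_add[OF bounded_linear.linear[OF lin]] by simp
  also have "\<dots> = abs_L1 (\<lambda>t. g1 t + g2 t)" by (rule abs_L1_add[symmetric]) (use g1 g2 in auto)
  finally have sum: "AE t in leb01. g t = g1 t + g2 t" using g g1 g2 by (subst (asm) abs_L1_eq_iff) auto
  have le_a: "Linf_norm (abs_L1 f1) \<le> ennreal a"
    unfolding Linf_norm_abs_L1[OF f1]
    by (rule esssup_I) (use a in \<open>auto simp: f1_def intro!: ennreal_leI\<close>)
  then have "Linf_norm (abs_L1 g1) \<le> ennreal a"
    using Linf[of "abs_L1 f1"] g1(2) by (auto simp: order_le_less_trans[OF _ ennreal_less_top])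
  then have "esssup leb01 (\<lambda>t. ennreal \<bar>g1 t\<bar>) \<le> ennreal a" using Linf_norm_abs_L1[OF g1(1)] by simp
  then have "AE t in leb01. ennreal \<bar>g1 t\<bar> \<le> ennreal a"
    using esssup_AE[of "\<lambda>t. ennreal \<bar>g1 t\<bar>" leb01] by (auto elim!: eventually_mono intro: order_trans)
  then have g1a: "AE t in leb01. \<bar>g1 t\<bar> \<le> a" using a by simp
  have "norm (S (abs_L1 f2)) \<le> onorm S * norm (abs_L1 f2)" by (rule onorm[OF lin])
  also have "\<dots> \<le> 1 * norm (abs_L1 f2)" by (rule mult_right_mono[OF norm]) simp
  finally have "(\<integral>t. \<bar>g2 t\<bar> \<partial>leb01) \<le> (\<integral>t. \<bar>f2 t\<bar> \<partial>leb01)"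
    using norm_abs_L1[OF f2] norm_abs_L1[OF g2(1)] g2(2) by simp
  then have n2: "(\<integral>\<^sup>+t. ennreal \<bar>g2 t\<bar> \<partial>leb01) \<le> (\<integral>\<^sup>+t. ennreal \<bar>f2 t\<bar> \<partial>leb01)"
    using f2 g2(1) by (simp add: nn_integral_eq_integral)
  \<comment> \<open>Almost everywhere \<open>\<bar>g t\<bar> \<le> \<bar>g1 t\<bar> + \<bar>g2
    t\<bar> \<le> a + \<bar>g2 t\<bar>\<close>. On the other side, \<open>\<bar>f2 t\<bar>\<close>
    is exactly the excess of \<open>\<bar>f t\<bar>\<close> over \<open>a\<close>.\<close>
  have "(\<integral>\<^sup>+t. ennreal (max 0 (\<bar>g t\<bar> - a)) \<partial>leb01) \<le> (\<integral>\<^sup>+t. ennreal \<bar>g2 t\<bar> \<partial>leb01)"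
  proof (rule nn_integral_mono_AE)
    show "AE t in leb01. ennreal (max 0 (\<bar>g t\<bar> - a)) \<le> ennreal \<bar>g2 t\<bar>"
      using sum g1a by eventually_elim (intro ennreal_leI, linarith)
  qed
  also note n2
  also have "(\<integral>\<^sup>+t. ennreal \<bar>f2 t\<bar> \<partial>leb01) = (\<integral>\<^sup>+t. ennreal (max 0 (\<bar>f t\<bar> - a)) \<partial>leb01)"
  proof (rule nn_integral_cong)
    fix t show "ennreal \<bar>f2 t\<bar> = ennreal (max 0 (\<bar>f t\<bar> - a))"
      by (rule arg_cong[of _ _ ennreal]) (use a in \<open>auto simp: f2_def f1_def max_def min_def abs_if\<close>)
  qed
  finally show ?thesis .
qed

section \<open>Slices of the cube\<close>

lemma space_cube: "\<omega> \<in> space cube \<longleftrightarrow> \<omega> \<in> (\<Pi>\<^sub>E i\<in>{1..}. {0..1})"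
  by (simp add: cube_def space_PiM)

lemma prob_space_cube: "prob_space cube"
  unfolding cube_def by (intro prob_space_PiM prob_space_leb01)

lemma coord_alg_mono:
  assumes "j \<le> k" shows "subalgebra (coord_alg k) (coord_alg j)"
proof -
  let ?G = "\<lambda>k. {(\<lambda>\<omega>. \<omega> i) -` A \<inter> space cube | i A. i \<in> {1..k} \<and> A \<in> sets leb01}"
  have G: "?G k \<subseteq> Pow (space cube)" for k by blast
  have "?G j \<subseteq> ?G k" using assms by force
  then have "sigma_sets (space cube) (?G j) \<subseteq> sigma_sets (space cube) (?G k)" by (rule sigma_sets_mono')
  then show ?thesis
    using G unfolding subalgebra_def coord_alg_def by (simp add: sets_measure_of space_measure_of)
qed

lemma martingale_filtration_cube: "martingale_filtration cube coord_alg"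
  by (intro martingale_filtration.intro prob_space_cube martingale_filtration_axioms.intro
      subalgebra_coord_alg coord_alg_mono)

lemma extend_point_in_cube:
  assumes "x \<in> space (\<Pi>\<^sub>M i\<in>{1..<k}. leb01)" "t \<in> {0..1}"
  shows "extend_point k x t \<in> space cube"
  using assms by (auto simp: space_cube extend_point_def space_PiM PiE_def Pi_def)

lemma extend_point_measurable [measurable]:
  "(\<lambda>(x, t). extend_point k x t) \<in> (\<Pi>\<^sub>M i\<in>{1..<k}. leb01) \<Otimes>\<^sub>M leb01 \<rightarrow>\<^sub>M cube"
proof -
  have "(\<lambda>z. if i < k then fst z i else if i = k then snd z else 0)
      \<in> (\<Pi>\<^sub>M i\<in>{1..<k}. leb01) \<Otimes>\<^sub>M leb01 \<rightarrow>\<^sub>M leb01" if "i \<in> {1..}" for i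
  proof (cases "i < k")
    case True
    then have "i \<in> {1..<k}" using that by simp
    then have "(\<lambda>z. fst z i) \<in> (\<Pi>\<^sub>M i\<in>{1..<k}. leb01) \<Otimes>\<^sub>M leb01 \<rightarrow>\<^sub>M leb01" by measurable
    then show ?thesis using True by simp
  next
    case False
    then show ?thesis by (cases "i = k") (auto intro: measurable_const)
  qed
  then show ?thesis
    unfolding cube_def extend_point_def case_prod_beta' by (rule measurable_restrict)
qed

text \<open>Since \<open>f\<close> depends only on the first \<open>k\<close> coordinates, its
  integral lives on a finite product, where Tonelli splits off coordinate \<open>k\<close>.\<close>

lemma nn_integral_cube_slice:
  fixes f :: "(nat \<Rightarrow> real) \<Rightarrow> real"
  assumes k: "1 \<le> k" and f: "f \<in> borel_measurable (coord_alg k)"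
  shows "(\<integral>\<^sup>+\<omega>. ennreal (f \<omega>) \<partial>cube) =
    (\<integral>\<^sup>+x. (\<integral>\<^sup>+t. ennreal (slice k f x t) \<partial>leb01) \<partial>(\<Pi>\<^sub>M i\<in>{1..<k}. leb01))"
proof -
  interpret unit_interval_product: product_prob_space "\<lambda>_. leb01" "{1..} :: nat set"
    by (intro product_prob_spaceI prob_space_leb01)
  let ?J = "{1..k}"
  \<comment> \<open>Padding by \<open>0\<close> does not change \<open>f\<close>, by
    \<open>coord_alg_determined\<close>, and agrees with the tail chosen in
    \<open>extend_point\<close>, so the inner integrand becomes the slice.\<close>
  define em :: "(nat \<Rightarrow> real) \<Rightarrow> nat \<Rightarrow> real" where "em y = (\<lambda>i\<in>{1..}. if i \<le> k then y i else 0)" for y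
  have J: "?J = insert k {1..<k}" using k by auto
  have em: "em \<in> (\<Pi>\<^sub>M i\<in>?J. leb01) \<rightarrow>\<^sub>M cube"
    unfolding cube_def em_def
  proof (rule measurable_restrict)
    fix i :: nat assume "i \<in> {1..}"
    then show "(\<lambda>y. if i \<le> k then y i else 0) \<in> (\<Pi>\<^sub>M i\<in>?J. leb01) \<rightarrow>\<^sub>M leb01"
      by (cases "i \<le> k") (auto intro: measurable_const)
  qed
  have fM: "f \<in> borel_measurable cube" using measurable_from_subalg[OF subalgebra_coord_alg f] .
  have [measurable]: "(\<lambda>y. f (em y)) \<in> borel_measurable (\<Pi>\<^sub>M i\<in>?J. leb01)"
    using measurable_compose[OF em fM] .
  have res [measurable]: "(\<lambda>\<omega>. restrict \<omega> ?J) \<in> cube \<rightarrow>\<^sub>M (\<Pi>\<^sub>M i\<in>?J. leb01)"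
    unfolding cube_def by (rule measurable_restrict_subset) auto
  have "f \<omega> = f (em (restrict \<omega> ?J))" if "\<omega> \<in> space cube" for \<omega>
    by (rule coord_alg_determined[OF f that measurable_space[OF em measurable_space[OF res that]]])
      (auto simp: em_def)
  then have "(\<integral>\<^sup>+\<omega>. ennreal (f \<omega>) \<partial>cube) = (\<integral>\<^sup>+\<omega>. ennreal (f (em (restrict \<omega> ?J))) \<partial>cube)"
    by (intro nn_integral_cong) simp
  also have "\<dots> = (\<integral>\<^sup>+y. ennreal (f (em y)) \<partial>distr cube (\<Pi>\<^sub>M i\<in>?J. leb01) (\<lambda>\<omega>. restrict \<omega> ?J))"
    by (rule nn_integral_distr[symmetric]) measurable
  also have "distr cube (\<Pi>\<^sub>M i\<in>?J. leb01) (\<lambda>\<omega>. restrict \<omega> ?J) = (\<Pi>\<^sub>M i\<in>?J. leb01)"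
    unfolding cube_def by (rule unit_interval_product.distr_PiM_restrict_finite) auto
  also have "(\<integral>\<^sup>+y. ennreal (f (em y)) \<partial>(\<Pi>\<^sub>M i\<in>?J. leb01)) =
      (\<integral>\<^sup>+x. (\<integral>\<^sup>+t. ennreal (f (em (x(k := t)))) \<partial>leb01) \<partial>(\<Pi>\<^sub>M i\<in>{1..<k}. leb01))"
    unfolding J by (rule unit_interval_product.product_nn_integral_insert) (simp, simp, unfold J[symmetric], measurable)
  also have "\<dots> = (\<integral>\<^sup>+x. (\<integral>\<^sup>+t. ennreal (slice k f x t) \<partial>leb01) \<partial>(\<Pi>\<^sub>M i\<in>{1..<k}. leb01))"
  proof -
    have "em (x(k := t)) = extend_point k x t" for x t
      by (auto simp: em_def extend_point_def fun_eq_iff)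
    then show ?thesis by (simp add: slice_def)
  qed
  finally show ?thesis .
qed

lemma slice_measurable_pair:
  assumes "f \<in> borel_measurable cube"
  shows "(\<lambda>(x, t). slice k f x t) \<in> borel_measurable ((\<Pi>\<^sub>M i\<in>{1..<k}. leb01) \<Otimes>\<^sub>M leb01)"
  using measurable_compose[OF extend_point_measurable assms] by (simp add: slice_def case_prod_beta')

lemma slice_measurable:
  assumes "f \<in> borel_measurable cube" "x \<in> space (\<Pi>\<^sub>M i\<in>{1..<k}. leb01)"
  shows "slice k f x \<in> borel_measurable leb01"
  using measurable_Pair2[OF slice_measurable_pair[OF assms(1)] assms(2)] by simp

text \<open>Tonelli for \<open>\<bar>f\<bar>\<close>: a finite iterated integral has finite inner
  integrals almost everywhere. This makes \<open>abs_L1\<close> of the slice meaningful.\<close>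

lemma AE_integrable_slice:
  fixes f :: "(nat \<Rightarrow> real) \<Rightarrow> real"
  assumes k: "1 \<le> k" and f: "f \<in> borel_measurable (coord_alg k)" and int: "integrable cube f"
  shows "AE x in (\<Pi>\<^sub>M i\<in>{1..<k}. leb01). integrable leb01 (slice k f x)"
proof -
  interpret leb: prob_space leb01 by (rule prob_space_leb01)
  let ?P = "\<Pi>\<^sub>M i\<in>{1..<k}. leb01"
  have fM: "f \<in> borel_measurable cube" using int by auto
  have "(\<integral>\<^sup>+x. (\<integral>\<^sup>+t. ennreal \<bar>slice k f x t\<bar> \<partial>leb01) \<partial>?P) = (\<integral>\<^sup>+\<omega>. ennreal \<bar>f \<omega>\<bar> \<partial>cube)"
    using f nn_integral_cube_slice[OF k, of "\<lambda>\<omega>. \<bar>f \<omega>\<bar>"] by (simp add: slice_def)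
  also have "\<dots> < \<infinity>" using int by (simp add: integrable_iff_bounded)
  finally have "(\<integral>\<^sup>+x. (\<integral>\<^sup>+t. ennreal \<bar>slice k f x t\<bar> \<partial>leb01) \<partial>?P) \<noteq> \<infinity>" by simp
  moreover have "(\<lambda>x. \<integral>\<^sup>+t. ennreal \<bar>slice k f x t\<bar> \<partial>leb01) \<in> borel_measurable ?P"
    using slice_measurable_pair[OF fM, of k] by (intro leb.borel_measurable_nn_integral) (simp add: case_prod_beta')
  ultimately have "AE x in ?P. (\<integral>\<^sup>+t. ennreal \<bar>slice k f x t\<bar> \<partial>leb01) \<noteq> \<infinity>"
    by (intro nn_integral_PInf_AE)
  then show ?thesis
    by (rule AE_mp) (auto intro!: AE_I2 slice_measurable[OF fM] simp: integrable_iff_bounded less_top)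
qed

text \<open>A weight in the first \<open>k - 1\<close> coordinates is constant along each slice and
  leaves the inner integral, which reduces the claim to \<open>L1_Linf_contraction_excess\<close> on
  almost every slice.\<close>

lemma cond_majorized_cube:
  fixes d e :: "(nat \<Rightarrow> real) \<Rightarrow> real"
  assumes k: "1 \<le> k"
    and d: "d \<in> borel_measurable (coord_alg k)" "integrable cube d"
    and e: "e \<in> borel_measurable (coord_alg k)" "integrable cube e"
    and S: "\<And>x. x \<in> space (\<Pi>\<^sub>M i\<in>{1..<k}. leb01) \<Longrightarrow> L1_Linf_contraction (S x)"
    and eq: "AE x in (\<Pi>\<^sub>M i\<in>{1..<k}. leb01). abs_L1 (slice k e x) = S x (abs_L1 (slice k d x))"
  shows "cond_majorized cube (coord_alg (k - 1)) e d"
  unfolding cond_majorized_def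
proof (intro allI impI)
  fix H :: "(nat \<Rightarrow> real) \<Rightarrow> real" and a :: real
  assume H: "H \<in> borel_measurable (coord_alg (k - 1))" "\<forall>\<omega>\<in>space cube. 0 \<le> H \<omega>" and a: "0 < a"
  let ?P = "\<Pi>\<^sub>M i\<in>{1..<k}. leb01"
  let ?N = "\<lambda>f x. \<integral>\<^sup>+t. ennreal (max 0 (\<bar>slice k f x t\<bar> - a)) \<partial>leb01"
  have [measurable]: "H \<in> borel_measurable (coord_alg k)"
    using measurable_from_subalg[OF coord_alg_mono H(1)] by simp
  have split: "(\<integral>\<^sup>+\<omega>. ennreal (H \<omega> * max 0 (\<bar>f \<omega>\<bar> - a)) \<partial>cube)
      = (\<integral>\<^sup>+x. ennreal (H (extend_point k x 0)) * ?N f x \<partial>?P)"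
    if [measurable]: "f \<in> borel_measurable (coord_alg k)" and f: "f \<in> borel_measurable cube" for f
  proof -
    have "(\<integral>\<^sup>+\<omega>. ennreal (H \<omega> * max 0 (\<bar>f \<omega>\<bar> - a)) \<partial>cube)
      = (\<integral>\<^sup>+x. (\<integral>\<^sup>+t. ennreal (slice k (\<lambda>\<omega>. H \<omega> * max 0 (\<bar>f \<omega>\<bar> - a)) x t) \<partial>leb01) \<partial>?P)"
      by (rule nn_integral_cube_slice[OF k]) measurable
    also have "\<dots> = (\<integral>\<^sup>+x. ennreal (H (extend_point k x 0)) * ?N f x \<partial>?P)"
    proof (rule nn_integral_cong)
      fix x assume x: "x \<in> space ?P"
      have Hx: "H (extend_point k x t) = H (extend_point k x 0)" if "t \<in> {0..1}" for t
        by (rule coord_alg_determined[OF H(1) extend_point_in_cube[OF x that] extend_point_in_cube[OF x]])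
          (auto simp: extend_point_def)
      have "(\<integral>\<^sup>+t. ennreal (slice k (\<lambda>\<omega>. H \<omega> * max 0 (\<bar>f \<omega>\<bar> - a)) x t) \<partial>leb01)
          = (\<integral>\<^sup>+t. ennreal (H (extend_point k x 0)) * ennreal (max 0 (\<bar>slice k f x t\<bar> - a)) \<partial>leb01)"
      proof (rule nn_integral_cong)
        fix t assume "t \<in> space leb01"
        then have t: "t \<in> {0..1}" by simp
        have "0 \<le> H (extend_point k x 0)" using H(2) extend_point_in_cube[OF x, of 0] by simp
        then show "ennreal (slice k (\<lambda>\<omega>. H \<omega> * max 0 (\<bar>f \<omega>\<bar> - a)) x t)
            = ennreal (H (extend_point k x 0)) * ennreal (max 0 (\<bar>slice k f x t\<bar> - a))"
          unfolding slice_def Hx[OF t] by (rule ennreal_mult')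
      qed
      also have "\<dots> = ennreal (H (extend_point k x 0)) * ?N f x"
        by (rule nn_integral_cmult) (use slice_measurable[OF f x] in simp)
      finally show "(\<integral>\<^sup>+t. ennreal (slice k (\<lambda>\<omega>. H \<omega> * max 0 (\<bar>f \<omega>\<bar> - a)) x t) \<partial>leb01)
        = ennreal (H (extend_point k x 0)) * ?N f x" .
    qed
    finally show ?thesis .
  qed
  have "AE x in ?P. ?N e x \<le> ?N d x"
    using eq AE_integrable_slice[OF k d] AE_integrable_slice[OF k e] AE_space
    by eventually_elim (rule L1_Linf_contraction_excess[OF S _ _ _ a])
  then have "(\<integral>\<^sup>+x. ennreal (H (extend_point k x 0)) * ?N e x \<partial>?P)
      \<le> (\<integral>\<^sup>+x. ennreal (H (extend_point k x 0)) * ?N d x \<partial>?P)"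
    by (intro nn_integral_mono_AE) (auto elim!: eventually_mono intro: mult_left_mono)
  then show "(\<integral>\<^sup>+\<omega>. ennreal (H \<omega> * max 0 (\<bar>e \<omega>\<bar> - a)) \<partial>cube) \<le> (\<integral>\<^sup>+\<omega>. ennreal (H \<omega> * max 0 (\<bar>d \<omega>\<bar> - a)) \<partial>cube)"
    using split[OF d(1)] split[OF e(1)] d(2) e(2) by (simp add: borel_measurable_integrable)
qed

section \<open>From p-th moments to norms\<close>

lemma Lp_norm_memLp:
  assumes "memLp p M X" shows "Lp_norm p M X = ennreal ((\<integral>\<omega>. \<bar>X \<omega>\<bar> powr p \<partial>M) powr (1 / p))"
  using assms by (simp add: Lp_norm_def memLp_def nn_integral_eq_integral)

lemma Lp_norm_not_memLp:
  assumes "X \<in> borel_measurable M" "\<not> memLp p M X" shows "Lp_norm p M X = \<infinity>"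
proof -
  have "(\<integral>\<^sup>+\<omega>. ennreal (\<bar>X \<omega>\<bar> powr p) \<partial>M) = \<infinity>"
    using assms by (auto simp: memLp_def integrable_iff_bounded less_top[symmetric])
  then show ?thesis by (simp add: Lp_norm_def)
qed

theorem theorem2:
  fixes p :: real
  assumes "1 < p"
  shows "\<exists>c::real. 0 < c \<and>
    (\<forall>(d :: nat \<Rightarrow> (nat \<Rightarrow> real) \<Rightarrow> real) (e :: nat \<Rightarrow> (nat \<Rightarrow> real) \<Rightarrow> real)
      (T :: nat \<Rightarrow> (nat \<Rightarrow> real) \<Rightarrow> L1 \<Rightarrow> L1).
       martingale_diff_seq cube coord_alg d \<longrightarrow>
       martingale_diff_seq cube coord_alg e \<longrightarrow>
       (\<forall>k\<ge>1. \<forall>x\<in>space (\<Pi>\<^sub>M i\<in>{1..<k}. leb01). L1_Linf_contraction (T k x)) \<longrightarrow>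
       (\<forall>k\<ge>1. \<forall>f. (\<lambda>x. T k x f) \<in> borel_measurable (\<Pi>\<^sub>M i\<in>{1..<k}. leb01)) \<longrightarrow>
       (\<forall>k\<ge>1. AE x in (\<Pi>\<^sub>M i\<in>{1..<k}. leb01).
          abs_L1 (slice k (e k) x) = T k x (abs_L1 (slice k (d k) x))) \<longrightarrow>
       (\<forall>n\<ge>1. Lp_norm p cube (\<lambda>\<omega>. \<Sum>k=1..n. e k \<omega>)
               \<le> ennreal c * Lp_norm p cube (\<lambda>\<omega>. \<Sum>k=1..n. d k \<omega>)))"
proof -
  \<comment> \<open>The potential is fixed before \<open>d\<close>, \<open>e\<close> and
    \<open>T\<close>, so all constants depend on \<open>p\<close> alone.\<close>
  obtain U g \<Psi> w A B C D L where "martingale_potential p U g \<Psi> w A B C D L"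
    using exists_potential[OF assms] by blast
  then interpret martingale_potential p U g \<Psi> w A B C D L .
  \<comment> \<open>The maximum with \<open>1\<close> secures \<open>0 < c\<close>, which also
    settles the case of an infinite norm of the sum of \<open>d\<close>: the right side is then
    infinite.\<close>
  define K where "K = max 1 (D * L powr p)"
  have K: "1 \<le> K" "D * L powr p \<le> K" by (auto simp: K_def)
  define c where "c = K powr (1 / p)"
  have c: "0 < c" using K by (simp add: c_def)
  show ?thesis
  proof (intro exI[of _ c] conjI allI impI c)
    fix d e :: "nat \<Rightarrow> (nat \<Rightarrow> real) \<Rightarrow> real" and T :: "nat \<Rightarrow> (nat \<Rightarrow> real) \<Rightarrow> L1 \<Rightarrow> L1" and n :: nat
    assume d: "martingale_diff_seq cube coord_alg d" and e: "martingale_diff_seq cube coord_alg e"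
      and T: "\<forall>k\<ge>1. \<forall>x\<in>space (\<Pi>\<^sub>M i\<in>{1..<k}. leb01). L1_Linf_contraction (T k x)"
      and eq: "\<forall>k\<ge>1. AE x in (\<Pi>\<^sub>M i\<in>{1..<k}. leb01).
          abs_L1 (slice k (e k) x) = T k x (abs_L1 (slice k (d k) x))"
    let ?X = "\<lambda>\<omega>. \<Sum>k=1..n. d k \<omega>" and ?Y = "\<lambda>\<omega>. \<Sum>k=1..n. e k \<omega>"
    have maj: "cond_majorized cube (coord_alg (k - 1)) (e k) (d k)" if "1 \<le> k" for k
      using that d e T eq by (intro cond_majorized_cube[where S = "T k"]) (auto simp: martingale_diff_seq_def)
    have X: "?X \<in> borel_measurable cube"
      using d by (intro borel_measurable_sum) (auto simp: martingale_diff_seq_def)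
    show "Lp_norm p cube ?Y \<le> ennreal c * Lp_norm p cube ?X"
    proof (cases "memLp p cube ?X")
      case True
      let ?I = "\<lambda>X. \<integral>\<omega>. \<bar>X \<omega>\<bar> powr p \<partial>cube"
      have Y: "memLp p cube ?Y"
        by (rule partial_sum_inequality(1)[OF martingale_filtration_cube d e _ True]) (rule maj)
      have le: "?I ?Y \<le> D * L powr p * ?I ?X"
        by (rule partial_sum_inequality(2)[OF martingale_filtration_cube d e _ True]) (rule maj)
      have I: "0 \<le> ?I X" for X :: "(nat \<Rightarrow> real) \<Rightarrow> real" by simp
      have "?I ?Y \<le> K * ?I ?X" using le mult_right_mono[OF K(2) I[of ?X]] by linarith
      then have "?I ?Y powr (1 / p) \<le> (K * ?I ?X) powr (1 / p)" using I p by (intro powr_mono2) auto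
      also have "\<dots> = c * ?I ?X powr (1 / p)" using K I by (simp add: c_def powr_mult)
      finally show ?thesis
        unfolding Lp_norm_memLp[OF True] Lp_norm_memLp[OF Y] using c
        by (simp add: ennreal_mult'[symmetric] ennreal_leI)
    next
      case False
      then show ?thesis using Lp_norm_not_memLp[OF X False] c by (simp add: ennreal_mult_top)
    qed
  qed
qed

end
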